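(* Let $i\geq 1$ and let $T$ be a semistandard reverse tableau of straight partition shape $\lambda$ such that $\lambda$ has an addable node in column $i$. Then $\mu_i(\rho^{-1}(T))$ is defined and $$\mu_i(\rho^{-1}(T))=\rho_{(1)}^{-1}\big(\mathrm{jdt}_i(T)\big).$$
   Context: Partitions and SSRTs (French convention): a partition $\lambda=(\lambda_1\geq\cdots\geq\lambda_k>0)$ is drawn with $\lambda_r$ left-justified boxes in row $r$, rows numbered from bottom to top and columns from left to right; $(r,c)$ is the box in row $r$, column $c$. An addable node of $\lambda$ is a position outside $\lambda$ whose addition gives a partition; it is determined by its column. A semistandard reverse tableau (SSRT) of shape $\lambda/\mu$ is a filling of the boxes of $\lambda/\mu$ by positive integers, weakly decreasing along rows from left to right and strictly decreasing along columns from bottom to top. $T_{(r,c)}$ denotes the entry in box $(r,c)$. Backward jeu de taquin: for an SSRT $T$ of straight shape $\lambda$ and an addable node $(i_0,j_0)$ of $\lambda$, $\mathrm{jdt}_{j_0}(T)$ is obtained as follows: set $c=(i_0,j_0)$; while $c\neq(1,1)$, writing $c=(p,q)$, let $c'$ be the box among $(p-1,q),(p,q-1)$ (those that exist) holding the smaller entry, with ties going to $(p-1,q)$; slide $T_{c'}$ into $c$ and set $c:=c'$. The result is an SSRT of skew shape $\lambda'/(1)$, where $\lambda'$ is $\lambda$ with the addable node added. Compositions and SSRCTs: a composition $\alpha=(\alpha_1,\ldots,\alpha_l)$ (positive parts) is drawn as its reverse composition diagram: row $r$, counted from top to bottom, has $\alpha_r$ left-justified boxes; $(r,c)$ is the box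 in row $r$ from the top, column $c$. $\widetilde{\alpha}$ is the partition obtained by sorting the parts of $\alpha$. Define $\alpha\lessdot_c\beta$ iff $\beta=(1,\alpha_1,\ldots,\alpha_l)$, or $\beta$ is obtained from $\alpha$ by adding $1$ to a part $\alpha_k$ such that $\alpha_s\neq\alpha_k$ for all $s<k$; let $\leq_c$ be the reflexive transitive closure. For $\beta\leq_c\alpha$ the skew shape $\alpha/\!\!/\beta$ consists of the boxes of $\alpha$ not in $\beta$, where $\beta$ is placed in the bottom-left corner of $\alpha$ (the parts of $\beta$ occupy, left-justified, the last $l(\beta)$ rows of $\alpha$). A semistandard reverse composition tableau (SSRCT) $\tau$ of shape $\alpha/\!\!/\beta$ is a filling of $\alpha/\!\!/\beta$ by positive integers such that (1) rows weakly decrease from left to right, (2) the entries of the first column strictly increase from top to bottom, (3) for rows $r<s$ and a column $c$ with $(s,c+1)\in\alpha/\!\!/\beta$: if $(r,c)\in\beta$ or $\tau(r,c)\geq\tau(s,c+1)$, then either $(r,c+1)\in\beta$ or both $(r,c+1)\in\alpha/\!\!/\beta$ and $\tau(r,c+1)>\tau(s,c+1)$. The map $\rho_\beta$: for an SSRCT $\tau$ of shape $\alpha/\!\!/\beta$, $\rho_\beta(\tau)$ is the SSRT obtained by writing the entries of each column of $\tau$ in decreasing order from bottom to top and bottom-justifying these columns on the inner shape $\widetilde{\beta}$. It is known that $\rho_\beta$ is a bijection from SSRCTs with inner shape $\beta$ to SSRTs with inner shape $\widetilde\beta$; $\rho=\rho_\varnothing$. The operation $\phi_{i+1}$ ($i\geq1$):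 let $\tau$ be an SSRCT of straight shape $\alpha$ having a part equal to $i$, and set $\tau(r,c)=0$ if $(r,c)\notin\alpha$. Let $r_1$ be the largest index with $\alpha_{r_1}=i$; for $j\geq2$ let $r_j$ be the largest $r<r_{j-1}$ with $\tau(r,i)>\tau(r_{j-1},i)\geq\tau(r,i+1)$, stopping at the last such index $r_k$. Then $\phi_{i+1}(\tau)$ is obtained by placing, for $j=k,k-1,\ldots,2$, the original entry $\tau(r_{j-1},i)$ into box $(r_j,i)$, and deleting box $(r_1,i)$ (deleting the row if it becomes empty); the entry $\tau(r_k,i)$ is said to exit. The operation $\mu_i$: for an SSRCT $\tau$ of straight shape, if $i=1$ let $\tau'=\tau$ and $H=\varnothing$; if $i\geq2$ let $\tau'=\phi_2(\phi_3(\cdots\phi_i(\tau)\cdots))$ and let $H$ be the multiset of the $i-1$ entries that exit. If $\tau'$ has shape $(\gamma_1,\ldots,\gamma_s)$, then $\mu_i(\tau)$ is the filling of $(\gamma_1,\ldots,\gamma_s,i)/\!\!/(1)$ whose first $s$ rows agree with $\tau'$ and whose last row has its first box empty and its remaining $i-1$ boxes filled with the elements of $H$ in decreasing order from left to right. *)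

theory Defs
  imports Main
begin

type_synonym filling = "nat \<times> nat \<Rightarrow> nat"
  (* a filling assigns entries to boxes (row, column), 1-indexed; 0 = no entry *)

section \<open>Partitions and semistandard reverse tableaux (French convention)\<close>

definition is_partition :: "nat list \<Rightarrow> bool" where
  "is_partition lam \<longleftrightarrow> sorted (rev lam) \<and> (\<forall>x\<in>set lam. 0 < x)"

(* row r (from bottom, 1-indexed) has lam!(r-1) boxes *)
definition pboxes :: "nat list \<Rightarrow> (nat \<times> nat) set" where
  "pboxes lam = {(r, c). 1 \<le> r \<and> r \<le> length lam \<and> 1 \<le> c \<and> c \<le> lam ! (r - 1)}"

definition addable_node :: "nat list \<Rightarrow> nat \<times> nat \<Rightarrow> bool" where
  "addable_node lam x \<longleftrightarrow> x \<notin> pboxes lam \<and>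
     (\<exists>nu. is_partition nu \<and> pboxes nu = insert x (pboxes lam))"

definition SSRT :: "nat list \<Rightarrow> nat list \<Rightarrow> filling \<Rightarrow> bool" where
  "SSRT lam mu T \<longleftrightarrow>
     (\<forall>x. x \<notin> pboxes lam - pboxes mu \<longrightarrow> T x = 0) \<and>
     (\<forall>x \<in> pboxes lam - pboxes mu. 0 < T x) \<and>
     (\<forall>r c. (r, c) \<in> pboxes lam - pboxes mu \<and> (r, Suc c) \<in> pboxes lam - pboxes mu
              \<longrightarrow> T (r, Suc c) \<le> T (r, c)) \<and>
     (\<forall>r c. (r, c) \<in> pboxes lam - pboxes mu \<and> (Suc r, c) \<in> pboxes lam - pboxes mu
              \<longrightarrow> T (Suc r, c) < T (r, c))"

function jdt_aux :: "filling \<Rightarrow> nat \<Rightarrow> nat \<Rightarrow> filling" where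
  "jdt_aux T p q =
    (if p \<le> 1 \<and> q \<le> 1 then T
     else if q \<le> 1 then jdt_aux (T((p, q) := T (p - 1, q), (p - 1, q) := 0)) (p - 1) q
     else if p \<le> 1 then jdt_aux (T((p, q) := T (p, q - 1), (p, q - 1) := 0)) p (q - 1)
     else if T (p - 1, q) \<le> T (p, q - 1)
       then jdt_aux (T((p, q) := T (p - 1, q), (p - 1, q) := 0)) (p - 1) q
       else jdt_aux (T((p, q) := T (p, q - 1), (p, q - 1) := 0)) p (q - 1))"
  by pat_completeness auto
termination by (relation "measure (\<lambda>(T, p, q). p + q)") auto

(* the addable node of lam in column j lies in row (height of column j) + 1 *)
definition jdt :: "nat list \<Rightarrow> nat \<Rightarrow> filling \<Rightarrow> filling" where
  "jdt lam j T = jdt_aux T (Suc (length (filter (\<lambda>x. j \<le> x) lam))) j"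

definition is_composition :: "nat list \<Rightarrow> bool" where
  "is_composition al \<longleftrightarrow> (\<forall>x\<in>set al. 0 < x)"

definition cover_c :: "nat list \<Rightarrow> nat list \<Rightarrow> bool" where
  "cover_c al be \<longleftrightarrow> be = 1 # al \<or>
     (\<exists>k < length al. (\<forall>s < k. al ! s \<noteq> al ! k) \<and> be = al[k := Suc (al ! k)])"

definition leq_c :: "nat list \<Rightarrow> nat list \<Rightarrow> bool" where
  "leq_c = cover_c\<^sup>*\<^sup>*"

(* reverse composition diagram: row r counted from the top, 1-indexed *)
definition cboxes :: "nat list \<Rightarrow> (nat \<times> nat) set" where
  "cboxes al = {(r, c). 1 \<le> r \<and> r \<le> length al \<and> 1 \<le> c \<and> c \<le> al ! (r - 1)}"

(* boxes of be placed in the bottom-left corner of al *)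
definition inner_boxes :: "nat list \<Rightarrow> nat list \<Rightarrow> (nat \<times> nat) set" where
  "inner_boxes al be = {(r, c). length al - length be < r \<and> r \<le> length al \<and> 1 \<le> c \<and>
       c \<le> be ! (r - (length al - length be) - 1)}"

definition skew_boxes :: "nat list \<Rightarrow> nat list \<Rightarrow> (nat \<times> nat) set" where
  "skew_boxes al be = cboxes al - inner_boxes al be"

definition SSRCT :: "nat list \<Rightarrow> nat list \<Rightarrow> filling \<Rightarrow> bool" where
  "SSRCT al be t \<longleftrightarrow>
     is_composition al \<and> is_composition be \<and> leq_c be al \<and>
     (\<forall>x. x \<notin> skew_boxes al be \<longrightarrow> t x = 0) \<and>
     (\<forall>x \<in> skew_boxes al be. 0 < t x) \<and>
     (\<forall>r c. (r, c) \<in> skew_boxes al be \<and> (r, Suc c) \<in> skew_boxes al be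
              \<longrightarrow> t (r, Suc c) \<le> t (r, c)) \<and>
     (\<forall>r s. r < s \<and> (r, 1) \<in> skew_boxes al be \<and> (s, 1) \<in> skew_boxes al be
              \<longrightarrow> t (r, 1) < t (s, 1)) \<and>
     (\<forall>r s c. r < s \<and> 1 \<le> c \<and> (s, Suc c) \<in> skew_boxes al be \<and>
              ((r, c) \<in> inner_boxes al be \<or> t (s, Suc c) \<le> t (r, c))
              \<longrightarrow> ((r, Suc c) \<in> inner_boxes al be \<or>
                   ((r, Suc c) \<in> skew_boxes al be \<and> t (s, Suc c) < t (r, Suc c))))"

definition col_entries :: "nat list \<Rightarrow> nat list \<Rightarrow> filling \<Rightarrow> nat \<Rightarrow> nat list" where
  "col_entries be al t c = [t (r, c). r \<leftarrow> [1..<Suc (length al)], (r, c) \<in> skew_boxes al be]"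

(* rho be al t: columns sorted decreasingly from bottom to top, bottom-justified on
   the partition obtained by sorting be (its column c has height #{parts of be >= c}) *)
definition rho :: "nat list \<Rightarrow> nat list \<Rightarrow> filling \<Rightarrow> filling" where
  "rho be al t = (\<lambda>(r, c).
     let L = rev (sort (col_entries be al t c));
         h = length (filter (\<lambda>x. c \<le> x) be)
     in if 1 \<le> c \<and> h < r \<and> r \<le> h + length L then L ! (r - h - 1) else 0)"

fun search :: "filling \<Rightarrow> nat \<Rightarrow> nat \<Rightarrow> nat \<Rightarrow> nat option" where
  "search t i r 0 = None"
| "search t i r (Suc m) =
     (if t (r, i) < t (Suc m, i) \<and> t (Suc m, Suc i) \<le> t (r, i) then Some (Suc m)
      else search t i r m)"

(* the sequence r_1, r_2, ..., r_k (fuel n suffices when n >= r_1, as the r_j decrease) *)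
fun chain :: "filling \<Rightarrow> nat \<Rightarrow> nat \<Rightarrow> nat \<Rightarrow> nat list" where
  "chain t i 0 r = [r]"
| "chain t i (Suc n) r =
     r # (case search t i r (r - 1) of None \<Rightarrow> [] | Some r' \<Rightarrow> chain t i n r')"

(* phi k (al, t) = phi_k applied to the SSRCT t of shape al (k = i+1 >= 2);
   returns the new shape, new filling, and the exiting entry *)
definition phi :: "nat \<Rightarrow> nat list \<times> filling \<Rightarrow> ((nat list \<times> filling) \<times> nat) option" where
  "phi k st = (let al = fst st; t = snd st; i = k - 1 in
     if k < 2 \<or> i \<notin> set al then None else
     let r1 = Max {r. 1 \<le> r \<and> r \<le> length al \<and> al ! (r - 1) = i};
         rs = chain t i r1 r1;
         t1 = fold (\<lambda>j f. f((rs ! Suc j, i) := t (rs ! j, i))) [0..<length rs - 1]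
                   (t((r1, i) := 0));
         ex = t (last rs, i);
         al1 = al[r1 - 1 := i - 1]
     in if i = 1
        then Some ((take (r1 - 1) al @ drop r1 al,
                    \<lambda>(r, c). if r < r1 then t1 (r, c) else t1 (Suc r, c)), ex)
        else Some ((al1, t1), ex))"

fun phis :: "nat \<Rightarrow> nat list \<times> filling \<Rightarrow> ((nat list \<times> filling) \<times> nat list) option" where
  "phis k st =
     (if k < 2 then Some (st, [])
      else case phi k st of
        None \<Rightarrow> None
      | Some (st', e) \<Rightarrow>
          (case phis (k - 1) st' of
             None \<Rightarrow> None
           | Some (st'', es) \<Rightarrow> Some (st'', e # es)))"

(* mu i (al, t): result is (shape, filling) of shape (gamma, i) // (1) *)
definition mu :: "nat \<Rightarrow> nat list \<times> filling \<Rightarrow> (nat list \<times> filling) option" where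
  "mu i st =
     (if i = 0 then None else
      case phis i st of
        None \<Rightarrow> None
      | Some ((ga, t'), H) \<Rightarrow>
          Some (ga @ [i],
                \<lambda>(r, c). if 1 \<le> r \<and> r \<le> length ga then t' (r, c)
                         else if r = Suc (length ga) \<and> 2 \<le> c \<and> c \<le> i
                           then rev (sort H) ! (c - 2) else 0))"

end

(* For a finite set S of positive integers let cnt S x be the number of elements of S that are
   at least x.  If A and B are the entries of columns c and c + 1 of a tableau, the entry e that
   jdt moves from column c to column c + 1 and the entry that exits under phi_{c+1} are both the
   unique e in A, not in B, with cnt A e = cnt B e + 1 and cnt B y < cnt A y for all 1 <= y <= e.
   On the SSRT side this holds because a hole in column c + 1 descends until it reaches the row of e
   in column c.  On the SSRCT side the triple condition shows that a row whose entry in column c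
   exceeds e also has an entry exceeding e in column c + 1, while the rows r_1, ..., r_k show
   strictness below e.  The same fact about rows makes phi preserve SSRCTs and lets the exiting
   entries be appended as a last row.  Since all columns are determined by their sets of entries,
   comparing these sets column by column gives the theorem. *)

theory Submission
  imports Defs
begin

section \<open>Entry sets of columns, their counting functions and decreasing listings\<close>

section \<open>Columns as sets\<close>

text \<open>A set suffices because the entries of a tableau column are pairwise distinct; the value
  0 marks an absent box and is therefore dropped.\<close>

definition col_set :: "filling \<Rightarrow> nat \<Rightarrow> nat set" where
  "col_set t c = {t (r, c) |r. t (r, c) \<noteq> 0}"

definition cnt :: "nat set \<Rightarrow> nat \<Rightarrow> nat" where
  "cnt S x = card {y \<in> S. x \<le> y}"

text \<open>This is the bottom-justified tableau column with entry set \<open>S\<close>. The default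
  0 matches the convention for fillings, and row 0 is always empty.\<close>

definition desc :: "nat set \<Rightarrow> nat \<Rightarrow> nat" where
  "desc S r = (if 1 \<le> r \<and> r \<le> card S then rev (sorted_list_of_set S) ! (r - 1) else 0)"

lemma desc_0 [simp]: "desc S 0 = 0"
  by (simp add: desc_def)

text \<open>In the increasing list of \<open>S\<close>, of length n, row \<open>r\<close> of the
  column is position n - r, and exactly \<open>r\<close> positions start there. This turns every
  comparison of entries into a comparison of counts.\<close>

lemma le_desc_iff:
  assumes "finite S" "1 \<le> r" "1 \<le> x"
  shows "x \<le> desc S r \<longleftrightarrow> r \<le> cnt S x"
proof -
  define L where "L = sorted_list_of_set S"
  have L: "sorted L" "distinct L" "set L = S" "length L = card S"
    using assms by (simp_all add: L_def)
  have card_le: "cnt S x \<le> card S"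
    unfolding cnt_def using assms(1) by (intro card_mono) auto
  show ?thesis
  proof (cases "r \<le> card S")
    case False
    then show ?thesis using card_le assms by (auto simp: desc_def)
  next
    case True
    define n where "n = card S"
    have d: "desc S r = L ! (n - r)"
      using True assms(2) L by (simp add: desc_def L_def[symmetric] rev_nth n_def)
    have c: "cnt S x = card {j. j < n \<and> x \<le> L ! j}"
    proof -
      have "{y \<in> S. x \<le> y} = (\<lambda>j. L ! j) ` {j. j < n \<and> x \<le> L ! j}"
        using L by (auto simp: n_def in_set_conv_nth[of _ L, unfolded L(3)])
      moreover have "inj_on (\<lambda>j. L ! j) {j. j < n \<and> x \<le> L ! j}"
        using L by (auto simp: inj_on_def n_def nth_eq_iff_index_eq)
      ultimately show ?thesis by (simp add: cnt_def card_image)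
    qed
    show ?thesis
    proof
      assume "x \<le> desc S r"
      then have "{n - r..<n} \<subseteq> {j. j < n \<and> x \<le> L ! j}"
        using d L sorted_nth_mono[of L] n_def by fastforce
      from card_mono[OF _ this] show "r \<le> cnt S x"
        using c True n_def by simp
    next
      assume le: "r \<le> cnt S x"
      show "x \<le> desc S r"
      proof (rule ccontr)
        assume "\<not> x \<le> desc S r"
        then have lt: "L ! (n - r) < x" using d by simp
        have "{j. j < n \<and> x \<le> L ! j} \<subseteq> {n - r<..<n}"
        proof clarsimp
          fix j assume "j < n" "x \<le> L ! j"
          then show "n - r < j"
              using lt sorted_nth_mono[of L j "n - r"] L assms True n_def
            by (cases "j \<le> n - r") auto
        qed
        from card_mono[OF _ this] have "cnt S x \<le> n - Suc (n - r)"
          using c by simp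
        then show False using le True assms(2) n_def by simp
      qed
    qed
  qed
qed

text \<open>A natural number is determined by the positive numbers that do not exceed it.\<close>

lemma desc_eqI:
  assumes "finite S" "1 \<le> r" "\<And>x. 1 \<le> x \<Longrightarrow> x \<le> y \<longleftrightarrow> r \<le> cnt S x"
  shows "desc S r = y"
proof -
  have *: "x \<le> desc S r \<longleftrightarrow> x \<le> y" if "1 \<le> x" for x
    using le_desc_iff[OF assms(1,2) that] assms(3)[OF that] by simp
  show ?thesis
    using *[of "desc S r"] *[of y] by (cases "y = 0"; cases "desc S r = 0"; force)
qed

lemma cnt_insert:
  assumes "finite S" "e \<notin> S"
  shows "cnt (insert e S) x = cnt S x + (if x \<le> e then 1 else 0)"
proof -
  have "{y \<in> insert e S. x \<le> y} =
      (if x \<le> e then insert e {y \<in> S. x \<le> y} else {y \<in> S. x \<le> y})"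
    by auto
  then show ?thesis using assms by (simp add: cnt_def)
qed

lemma cnt_antimono: "finite S \<Longrightarrow> x \<le> y \<Longrightarrow> cnt S y \<le> cnt S x"
  unfolding cnt_def by (intro card_mono) auto

lemma cnt_le_card: "finite S \<Longrightarrow> cnt S x \<le> card S"
  unfolding cnt_def by (intro card_mono) auto

text \<open>A new entry raises the counting function by one at all arguments up to \<open>e\<close>,
  which pushes the smaller entries up by one row.\<close>

lemma desc_insert:
  assumes "finite S" "e \<notin> S" "1 \<le> e" 
  shows "desc (insert e S) r =
    (if r < Suc (cnt S e) then desc S r else if r = Suc (cnt S e) then e else desc S (r - 1))"
proof (cases "r = 0")
  case False
  have key: "x \<le> (if r < Suc (cnt S e) then desc S r else if r = Suc (cnt S e) then e
      else desc S (r - 1)) \<longleftrightarrow> r \<le> cnt (insert e S) x" if x: "1 \<le> x" for x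
  proof -
    have a: "x \<le> e \<Longrightarrow> cnt S e \<le> cnt S x" and b: "\<not> x \<le> e \<Longrightarrow> cnt S x \<le> cnt S e"
      using cnt_antimono[OF assms(1)] by simp_all
    consider "r < Suc (cnt S e)" | "r = Suc (cnt S e)" | "r > Suc (cnt S e)" by linarith
    then show ?thesis
    proof cases
      case 1
      then show ?thesis
        using le_desc_iff[OF assms(1) _ x, of r] False a b cnt_insert[OF assms(1,2)]
        by auto
    next
      case 2
      then show ?thesis using a b cnt_insert[OF assms(1,2), of x] by auto
    next
      case 3
      then show ?thesis
        using le_desc_iff[OF assms(1) _ x, of "r - 1"] a b cnt_insert[OF assms(1,2), of x]
        by auto
    qed
  qed
  show ?thesis
    using assms(1) False by (intro desc_eqI key) simp_all
qed simp

lemma desc_eq_0_iff: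
  assumes "finite S" "0 \<notin> S" "1 \<le> r"
  shows "desc S r = 0 \<longleftrightarrow> card S < r"
proof -
  have "{y \<in> S. 1 \<le> y} = S" using assms(2) by (auto simp: Suc_le_eq intro: ccontr)
  then have "cnt S 1 = card S" by (simp add: cnt_def)
  then show ?thesis using le_desc_iff[OF assms(1,3) order_refl] by linarith
qed

section \<open>Backward jeu de taquin, column by column\<close>

section \<open>Backward slides\<close>

declare jdt_aux.simps [simp del]

text \<open>For the entries \<open>A\<close>, \<open>B\<close> of two adjacent columns this determines \<open>e\<close> uniquely.\<close>

definition exits :: "nat set \<Rightarrow> nat set \<Rightarrow> nat \<Rightarrow> bool" where
  "exits A B e \<longleftrightarrow> e \<in> A \<and> e \<notin> B \<and> cnt A e = Suc (cnt B e) \<and>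
     (\<forall>y. 1 \<le> y \<and> y \<le> e \<longrightarrow> cnt B y < cnt A y)"

text \<open>This is the state of a column during a slide, with the empty box in row
  \<open>p\<close>.\<close>

definition hole_col :: "nat set \<Rightarrow> nat \<Rightarrow> nat \<Rightarrow> nat" where
  "hole_col S p r = (if r < p then desc S r else if r = p then 0 else desc S (r - 1))"

text \<open>In column 1 the hole can only descend, so every entry below it moves up by one and the
  hole ends in row 1.\<close>

lemma jdt_first_column:
  assumes "1 \<le> p" "\<And>r. F (r, 1) = hole_col B p r"
  shows "jdt_aux F p 1 = (\<lambda>(r, c). if c = 1 then desc B (r - 1) else F (r, c))"
  using assms
proof (induction p arbitrary: F rule: less_induct)
  case (less p)
  show ?case
  proof (cases "p = 1")
    case True
    then show ?thesis using less.prems by (subst jdt_aux.simps) (auto simp: fun_eq_iff hole_col_def)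
  next
    case False
    define F' where "F' = F((p, 1) := F (p - 1, 1), (p - 1, 1) := 0)"
    have "jdt_aux F p 1 = jdt_aux F' (p - 1) 1"
      using False less.prems(1) by (subst jdt_aux.simps) (auto simp: F'_def)
    also have "\<dots> = (\<lambda>(r, c). if c = 1 then desc B (r - 1) else F' (r, c))"
    proof (rule less.IH)
      show "F' (r, 1) = hole_col B (p - 1) r" for r
        using less.prems False by (auto simp: F'_def hole_col_def)
    qed (use less.prems False in auto)
    also have "\<dots> = (\<lambda>(r, c). if c = 1 then desc B (r - 1) else F (r, c))"
      by (auto simp: F'_def fun_eq_iff)
    finally show ?thesis .
  qed
qed

text \<open>These facts steer a hole in column \<open>B\<close> with \<open>A\<close> on its left.
  Above row \<open>Suc (cnt B e)\<close> the entry under the hole is at most the entry to its left;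
  in that row the left neighbour is \<open>e\<close>, and any entry under the hole exceeds
  \<open>e\<close>.\<close>

lemma exits_desc:
  assumes "finite A" "finite B" "0 \<notin> A" "exits A B e"
  shows "desc A (Suc (cnt B e)) = e"
    and "cnt B e \<noteq> 0 \<Longrightarrow> e < desc B (cnt B e)"
    and "Suc (cnt B e) < p \<Longrightarrow> desc B (p - 1) \<le> desc A p"
    and "hole_col (A - {e}) (Suc (cnt B e)) r = (if r = Suc (cnt B e) then 0 else desc A r)"
proof -
  have e: "1 \<le> e" "e \<in> A" "e \<notin> B" "cnt A e = Suc (cnt B e)"
    using assms by (cases e; simp add: exits_def)+
  have ins: "insert e (A - {e}) = A" using e by auto
  have cA: "cnt (A - {e}) e = cnt B e"
    using cnt_insert[of "A - {e}" e e] ins e assms by simp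
  have dA: "desc A r = (if r < Suc (cnt B e) then desc (A - {e}) r
      else if r = Suc (cnt B e) then e else desc (A - {e}) (r - 1))" for r
    using desc_insert[of "A - {e}" e r] ins cA e assms by simp
  show "desc A (Suc (cnt B e)) = e" using dA by simp
  show "hole_col (A - {e}) (Suc (cnt B e)) r = (if r = Suc (cnt B e) then 0 else desc A r)"
    using dA by (simp add: hole_col_def)
  show "e < desc B (cnt B e)" if "cnt B e \<noteq> 0"
  proof -
    have "{y \<in> B. Suc e \<le> y} = {y \<in> B. e \<le> y}" using e by (auto simp: Suc_le_eq le_less)
    then have "cnt B (Suc e) = cnt B e" by (simp add: cnt_def)
    then show ?thesis using le_desc_iff[OF assms(2), of "cnt B e" "Suc e"] that by simp
  qed
  show "desc B (p - 1) \<le> desc A p" if p: "Suc (cnt B e) < p"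
  proof (cases "desc B (p - 1) = 0")
    case False
    let ?y = "desc B (p - 1)"
    \<comment> \<open>Row \<open>p - 1\<close> lies above the \<open>cnt B e\<close> entries of
      \<open>B\<close> that reach \<open>e\<close>, so its entry is below \<open>e\<close> and the
      strict inequality in \<open>exits\<close> applies to it.\<close>
    have "\<not> e \<le> ?y" using le_desc_iff[OF assms(2), of "p - 1" e] p e by auto
    then have "cnt B ?y < cnt A ?y" using assms(4) False by (auto simp: exits_def)
    moreover have "p - 1 \<le> cnt B ?y" using le_desc_iff[OF assms(2), of "p - 1" ?y] p False by auto
    ultimately show ?thesis using le_desc_iff[OF assms(1), of p ?y] p False by auto
  qed simp
qed

text \<open>Induction on the row of the hole: it descends to row \<open>Suc (cnt B e)\<close> and
  there moves left, pulling \<open>e\<close> into column \<open>Suc q\<close>.\<close>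

lemma jdt_column:
  assumes "finite A" "finite B" "0 \<notin> A" "exits A B e" "0 < q"
    and "Suc (cnt B e) \<le> p"
    and "\<And>r. F (r, Suc q) = hole_col B p r" "\<And>r. F (r, q) = desc A r"
  shows "jdt_aux F p (Suc q) = jdt_aux
    (\<lambda>(r, c). if c = Suc q then desc (insert e B) r
      else if c = q then hole_col (A - {e}) (Suc (cnt B e)) r else F (r, c))
    (Suc (cnt B e)) q"
  using assms(6-8)
proof (induction p arbitrary: F rule: less_induct)
  case (less p)
  note ex = exits_desc[OF assms(1-4)]
  have e: "1 \<le> e" "e \<notin> B" using assms by (cases e; simp add: exits_def)+
  show ?case
  proof (cases "p = Suc (cnt B e)")
    case True
    \<comment> \<open>In row 1 there is no box underneath; otherwise the entry underneath exceeds
      \<open>e\<close>. Either way the hole moves left.\<close>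
    have "jdt_aux F p (Suc q) = jdt_aux (F((p, Suc q) := F (p, q), (p, q) := 0)) p q"
      using assms(5) True less.prems ex(1,2)
      by (subst jdt_aux.simps) (auto simp: hole_col_def)
    also have "F((p, Suc q) := F (p, q), (p, q) := 0) =
      (\<lambda>(r, c). if c = Suc q then desc (insert e B) r
      else if c = q then hole_col (A - {e}) (Suc (cnt B e)) r else F (r, c))"
      using assms(5) True less.prems ex(1,4) desc_insert[OF assms(2) e(2,1)]
      by (auto simp: fun_eq_iff hole_col_def)
    finally show ?thesis using True by simp
  next
    case False
    then have p: "Suc (cnt B e) < p" using less.prems by simp
    define F' where "F' = F((p, Suc q) := F (p - 1, Suc q), (p - 1, Suc q) := 0)"
    \<comment> \<open>A weak inequality is enough for a downward move, since ties go to the box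
      underneath.\<close>
    have "F (p - 1, Suc q) \<le> F (p, q)"
      using ex(3)[OF p] less.prems(2,3) p by (simp add: hole_col_def)
    then have "jdt_aux F p (Suc q) = jdt_aux F' (p - 1) (Suc q)"
      using assms(5) p by (simp add: jdt_aux.simps[of F p "Suc q"] F'_def)
    also have "\<dots> = jdt_aux
      (\<lambda>(r, c). if c = Suc q then desc (insert e B) r
        else if c = q then hole_col (A - {e}) (Suc (cnt B e)) r else F' (r, c))
      (Suc (cnt B e)) q"
    proof (rule less.IH)
      show "F' (r, Suc q) = hole_col B (p - 1) r" for r
        using less.prems p by (auto simp: F'_def hole_col_def)
      show "F' (r, q) = desc A r" for r
        using less.prems assms(5) by (auto simp: F'_def)
    qed (use p in auto)
    also have "(\<lambda>(r, c). if c = Suc q then desc (insert e B) r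
        else if c = q then hole_col (A - {e}) (Suc (cnt B e)) r else F' (r, c)) =
      (\<lambda>(r, c). if c = Suc q then desc (insert e B) r
        else if c = q then hole_col (A - {e}) (Suc (cnt B e)) r else F (r, c))"
      by (auto simp: F'_def fun_eq_iff)
    finally show ?thesis .
  qed
qed

text \<open>The columns are processed from right to left. When the hole is in column
  \<open>q < k\<close>, that column has already given up \<open>e (Suc q)\<close>, hence the set
  difference. The set \<open>B\<close> for the current column is kept general so that the induction
  can hand over a column that has lost an entry.\<close>

lemma jdt_columns:
  fixes A :: "nat \<Rightarrow> nat set" and e :: "nat \<Rightarrow> nat"
  assumes "\<And>c. finite (A c)" "\<And>c. 0 \<notin> A c"
    and "\<And>q. 2 \<le> q \<Longrightarrow> q \<le> k \<Longrightarrow>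
      exits (A (q - 1)) (if q = k then B else A q - {e (Suc q)}) (e q)"
    and "\<And>q. 2 \<le> q \<Longrightarrow> q < k \<Longrightarrow> e (Suc q) \<le> e q"
    and "1 \<le> k" "finite B" "1 \<le> p" "k \<noteq> 1 \<Longrightarrow> Suc (cnt B (e k)) \<le> p"
    and "\<And>r. F (r, k) = hole_col B p r" "\<And>r c. c < k \<Longrightarrow> F (r, c) = desc (A c) r"
  shows "jdt_aux F p k = (\<lambda>(r, c).
    if c = 0 \<or> k < c then F (r, c)
    else let D = (if c = k then B else A c - {e (Suc c)})
      in if c = 1 then desc D (r - 1) else desc (insert (e c) D) r)"
  using assms(3-)
proof (induction k arbitrary: B p F)
  case (Suc k)
  show ?case
  proof (cases "k = 0")
    case True
    then show ?thesis using jdt_first_column[of p F B] Suc.prems by (auto simp: fun_eq_iff Let_def)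
  next
    case False
    let ?e = "e (Suc k)"
    define F' where "F' = (\<lambda>(r, c). if c = Suc k then desc (insert ?e B) r
      else if c = k then hole_col (A k - {?e}) (Suc (cnt B ?e)) r else F (r, c))"
    have exk: "exits (A k) B ?e" using Suc.prems(1)[of "Suc k"] False by simp
    have ek: "?e \<in> A k" "cnt (A k) ?e = Suc (cnt B ?e)" using exk by (auto simp: exits_def)
    have "jdt_aux F p (Suc k) = jdt_aux F' (Suc (cnt B ?e)) k"
      using jdt_column[of "A k" B ?e k p F] assms(1,2) exk Suc.prems(4-) False
      by (simp add: F'_def)
    also have "\<dots> = (\<lambda>(r, c).
      if c = 0 \<or> k < c then F' (r, c)
      else let D = (if c = k then A k - {?e} else A c - {e (Suc c)})
        in if c = 1 then desc D (r - 1) else desc (insert (e c) D) r)"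
    proof (rule Suc.IH)
      show "exits (A (q - 1)) (if q = k then A k - {?e} else A q - {e (Suc q)}) (e q)"
        if "2 \<le> q" "q \<le> k" for q
        using Suc.prems(1)[of q] that by (auto split: if_splits)
      show "e (Suc q) \<le> e q" if "2 \<le> q" "q < k" for q
        using Suc.prems(2) that by simp
      \<comment> \<open>The hole enters column \<open>k\<close> in the row vacated by
        \<open>?e\<close>. Since \<open>?e\<close> is at most \<open>e k\<close>, this row is not
        below the one where the hole must leave again.\<close>
      show "Suc (cnt (A k - {?e}) (e k)) \<le> Suc (cnt B ?e)" if "k \<noteq> 1"
      proof -
        have "?e \<le> e k" using Suc.prems(2)[of k] that False by simp
        then have "cnt (A k - {?e}) (e k) \<le> cnt (A k - {?e}) ?e"
          using assms(1) by (intro cnt_antimono) auto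
        also have "\<dots> = cnt B ?e"
          using cnt_insert[of "A k - {?e}" ?e ?e] ek assms(1) by (simp add: insert_absorb)
        finally show ?thesis by simp
      qed
    qed (use False assms(1) Suc.prems in \<open>auto simp: F'_def\<close>)
    also have "\<dots> = (\<lambda>(r, c).
      if c = 0 \<or> Suc k < c then F (r, c)
      else let D = (if c = Suc k then B else A c - {e (Suc c)})
        in if c = 1 then desc D (r - 1) else desc (insert (e c) D) r)"
      using False by (auto simp: fun_eq_iff F'_def Let_def not_less less_Suc_eq_le dest: le_antisym)
    finally show ?thesis .
  qed
qed simp

section \<open>Zero-extended composition tableaux and counts in their columns\<close>

section \<open>Composition tableaux of straight shape\<close>

text \<open>The conditions of an SSRCT with empty inner shape, stated on the filling
extended by \<open>0\<close>. Parts of \<open>al\<close> may be \<open>0\<close>, which covers the moment at which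
the only box of a row has been removed but the empty row is still present.\<close>

definition comp_tableau :: "nat list \<Rightarrow> filling \<Rightarrow> bool" where
  "comp_tableau al t \<longleftrightarrow>
     (\<forall>r c. t (r, c) \<noteq> 0 \<longleftrightarrow> (r, c) \<in> cboxes al) \<and>
     (\<forall>r c. 1 \<le> c \<longrightarrow> t (r, Suc c) \<le> t (r, c)) \<and>
     (\<forall>r s. r < s \<and> t (r, 1) \<noteq> 0 \<and> t (s, 1) \<noteq> 0 \<longrightarrow> t (r, 1) < t (s, 1)) \<and>
     (\<forall>r s c. r < s \<and> 1 \<le> c \<and> t (s, Suc c) \<noteq> 0 \<and> t (s, Suc c) \<le> t (r, c)
        \<longrightarrow> t (s, Suc c) < t (r, Suc c))"

lemma comp_tableauD:
  assumes "comp_tableau al t"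
  shows "t (r, c) \<noteq> 0 \<longleftrightarrow> (r, c) \<in> cboxes al"
    and "1 \<le> c \<Longrightarrow> t (r, Suc c) \<le> t (r, c)"
    and "r < s \<Longrightarrow> t (r, 1) \<noteq> 0 \<Longrightarrow> t (s, 1) \<noteq> 0 \<Longrightarrow> t (r, 1) < t (s, 1)"
    and "r < s \<Longrightarrow> 1 \<le> c \<Longrightarrow> t (s, Suc c) \<noteq> 0 \<Longrightarrow> t (s, Suc c) \<le> t (r, c) \<Longrightarrow>
      t (s, Suc c) < t (r, Suc c)"
  using assms by (simp_all add: comp_tableau_def)

lemma skew_boxes_Nil: "skew_boxes al [] = cboxes al"
  by (auto simp: skew_boxes_def inner_boxes_def)

lemma SSRCT_D:
  assumes "SSRCT al be t"
  shows "t x \<noteq> 0 \<longleftrightarrow> x \<in> skew_boxes al be"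
    and "(r, c) \<in> skew_boxes al be \<Longrightarrow> (r, Suc c) \<in> skew_boxes al be \<Longrightarrow>
      t (r, Suc c) \<le> t (r, c)"
    and "r < s \<Longrightarrow> (r, 1) \<in> skew_boxes al be \<Longrightarrow> (s, 1) \<in> skew_boxes al be \<Longrightarrow>
      t (r, 1) < t (s, 1)"
    and "r < s \<Longrightarrow> 1 \<le> c \<Longrightarrow> (s, Suc c) \<in> skew_boxes al be \<Longrightarrow>
      (r, c) \<in> inner_boxes al be \<or> t (s, Suc c) \<le> t (r, c) \<Longrightarrow>
      (r, Suc c) \<in> inner_boxes al be \<or>
      (r, Suc c) \<in> skew_boxes al be \<and> t (s, Suc c) < t (r, Suc c)"
proof -
  note a = assms[unfolded SSRCT_def]
  from a have "\<forall>x. x \<notin> skew_boxes al be \<longrightarrow> t x = 0" by (elim conjE)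
  then have "x \<notin> skew_boxes al be \<Longrightarrow> t x = 0" by iprover
  moreover from a have "\<forall>x \<in> skew_boxes al be. 0 < t x" by (elim conjE)
  then have "x \<in> skew_boxes al be \<Longrightarrow> 0 < t x" by (rule bspec)
  ultimately show "t x \<noteq> 0 \<longleftrightarrow> x \<in> skew_boxes al be" by linarith
  from a have "\<forall>r c. (r, c) \<in> skew_boxes al be \<and> (r, Suc c) \<in> skew_boxes al be
              \<longrightarrow> t (r, Suc c) \<le> t (r, c)" by (elim conjE)
  then show "(r, c) \<in> skew_boxes al be \<Longrightarrow> (r, Suc c) \<in> skew_boxes al be \<Longrightarrow>
      t (r, Suc c) \<le> t (r, c)" by simp
  from a have "\<forall>r s. r < s \<and> (r, 1) \<in> skew_boxes al be \<and> (s, 1) \<in> skew_boxes al be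
              \<longrightarrow> t (r, 1) < t (s, 1)" by (elim conjE)
  then show "r < s \<Longrightarrow> (r, 1) \<in> skew_boxes al be \<Longrightarrow> (s, 1) \<in> skew_boxes al be \<Longrightarrow>
      t (r, 1) < t (s, 1)" by simp
  from a have "\<forall>r s c. r < s \<and> 1 \<le> c \<and> (s, Suc c) \<in> skew_boxes al be \<and>
              ((r, c) \<in> inner_boxes al be \<or> t (s, Suc c) \<le> t (r, c))
              \<longrightarrow> ((r, Suc c) \<in> inner_boxes al be \<or>
                   ((r, Suc c) \<in> skew_boxes al be \<and> t (s, Suc c) < t (r, Suc c)))"
    by (elim conjE)
  then show "r < s \<Longrightarrow> 1 \<le> c \<Longrightarrow> (s, Suc c) \<in> skew_boxes al be \<Longrightarrow>
      (r, c) \<in> inner_boxes al be \<or> t (s, Suc c) \<le> t (r, c) \<Longrightarrow>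
      (r, Suc c) \<in> inner_boxes al be \<or>
      (r, Suc c) \<in> skew_boxes al be \<and> t (s, Suc c) < t (r, Suc c)" by simp
qed

lemma SSRCT_Nil_comp_tableau:
  assumes "SSRCT al [] t"
  shows "comp_tableau al t"
proof -
  note D = SSRCT_D[OF assms, unfolded skew_boxes_Nil]
  have inner: "inner_boxes al [] = {}" by (auto simp: inner_boxes_def)
  have mem: "(r, c) \<in> cboxes al" if "(r, Suc c) \<in> cboxes al" "1 \<le> c" for r c
    using that by (auto simp: cboxes_def)
  show ?thesis
    unfolding comp_tableau_def
  proof (intro conjI allI impI)
    show "t (r, c) \<noteq> 0 \<longleftrightarrow> (r, c) \<in> cboxes al" for r c by (rule D(1))
    show "t (r, Suc c) \<le> t (r, c)" if "1 \<le> c" for r c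
      using D(1)[of "(r, Suc c)"] D(2)[of r c] mem[of r c] that
      by (cases "t (r, Suc c) = 0") auto
    show "t (r, 1) < t (s, 1)" if "r < s \<and> t (r, 1) \<noteq> 0 \<and> t (s, 1) \<noteq> 0" for r s
      using D(1,3) that by simp
    show "t (s, Suc c) < t (r, Suc c)"
      if "r < s \<and> 1 \<le> c \<and> t (s, Suc c) \<noteq> 0 \<and> t (s, Suc c) \<le> t (r, c)" for r s c
      using D(4)[of r s c] D(1)[of "(s, Suc c)"] that by (simp add: inner)
  qed
qed

text \<open>Column 1 is strictly increasing. In a later column, if rows r < s had equal entries, the
  entry of row s would be at most the left neighbour in row r (or that neighbour is an inner box),
  so the triple condition would make it strictly smaller than the entry of row r.\<close>

lemma SSRCT_inj:
  assumes "SSRCT al be t" "(r, c) \<in> skew_boxes al be" "(s, c) \<in> skew_boxes al be"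
    "t (r, c) = t (s, c)"
  shows "r = s"
proof -
  have neq: "t (r, c) \<noteq> t (s, c)"
    if "r < s" and box: "(r, c) \<in> skew_boxes al be" "(s, c) \<in> skew_boxes al be" for r s
  proof (cases c)
    case 0
    then show ?thesis using box by (auto simp: skew_boxes_def cboxes_def)
  next
    case (Suc d)
    show ?thesis
    proof (cases "d = 0")
      case True
      then show ?thesis using SSRCT_D(3)[OF assms(1), of r s] Suc that by simp
    next
      case False
      then have d: "1 \<le> d" by simp
      have "(r, d) \<in> inner_boxes al be \<or> (r, d) \<in> skew_boxes al be"
        using box d Suc by (auto simp: skew_boxes_def cboxes_def)
      then have "(r, d) \<in> inner_boxes al be \<or> t (r, c) \<le> t (r, d)"
        using SSRCT_D(2)[OF assms(1)] Suc box by auto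
      moreover have "(r, c) \<notin> inner_boxes al be" using box by (simp add: skew_boxes_def)
      ultimately show ?thesis
        using SSRCT_D(4)[OF assms(1), of r s d] Suc box d \<open>r < s\<close> by auto
    qed
  qed
  then show ?thesis using assms(2-4) by (metis nat_neq_iff)
qed

lemma comp_tableau_inj:
  assumes "comp_tableau al t" "t (r, c) \<noteq> 0" "t (r, c) = t (s, c)"
  shows "r = s"
proof -
  have neq: "t (r, c) \<noteq> t (s, c)" if "r < s" "t (r, c) \<noteq> 0" "t (s, c) \<noteq> 0" for r s
  proof (cases c)
    case 0
    then show ?thesis using that comp_tableauD(1)[OF assms(1), of r c] by (auto simp: cboxes_def)
  next
    case (Suc d)
    then show ?thesis
      using comp_tableauD(3)[OF assms(1), of r s] comp_tableauD(4)[OF assms(1), of r s d]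
        comp_tableauD(2)[OF assms(1), of d r] that by (cases "d = 0") auto
  qed
  then show ?thesis using assms(2,3) by (metis nat_neq_iff)
qed

lemma finite_cboxes: "finite (cboxes al)"
proof (rule finite_subset)
  show "cboxes al \<subseteq> {..length al} \<times> {..Max (insert 0 (set al))}"
    by (auto simp: cboxes_def intro!: order.trans[OF _ Max_ge])
qed simp

lemma comp_tableau_finite_rows: "comp_tableau al t \<Longrightarrow> finite {r. t (r, c) \<noteq> 0}"
  by (rule finite_subset[of _ "fst ` cboxes al"])
    (auto simp: comp_tableauD(1) finite_cboxes intro!: image_eqI[of _ fst "(_, c)"] simp del: neq0_conv)

lemma col_set_iff: "y \<in> col_set t c \<longleftrightarrow> y \<noteq> 0 \<and> (\<exists>r. t (r, c) = y)"
  unfolding col_set_def by blast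

lemma col_set_eq: "col_set t c = (\<lambda>r. t (r, c)) ` {r. t (r, c) \<noteq> 0}"
  by (auto simp: col_set_def)

lemma finite_col_set: "comp_tableau al t \<Longrightarrow> finite (col_set t c)"
  unfolding col_set_eq by (intro finite_imageI comp_tableau_finite_rows)

lemma zero_notin_col_set [simp]: "0 \<notin> col_set t c"
  by (auto simp: col_set_def)

text \<open>Distinctness lets entries be counted by rows, so counts of adjacent columns can be
  compared row by row. The bound on \<open>x\<close> excludes absent boxes.\<close>

lemma cnt_col_set:
  assumes "comp_tableau al t" "1 \<le> x"
  shows "cnt (col_set t c) x = card {r. x \<le> t (r, c)}"
proof -
  have "{y \<in> col_set t c. x \<le> y} = (\<lambda>r. t (r, c)) ` {r. x \<le> t (r, c)}"
    using assms(2) by (auto simp: col_set_def)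
  moreover have "inj_on (\<lambda>r. t (r, c)) {r. x \<le> t (r, c)}"
  proof (rule inj_onI)
    fix r s assume "r \<in> {r. x \<le> t (r, c)}" and eq: "t (r, c) = t (s, c)"
    then have "t (r, c) \<noteq> 0" using assms(2) by simp
    then show "r = s" using comp_tableau_inj[OF assms(1) _ eq] by blast
  qed
  ultimately show ?thesis by (simp add: cnt_def card_image)
qed

lemma comp_tableau_finite_ge: "comp_tableau al t \<Longrightarrow> 1 \<le> x \<Longrightarrow> finite {r. x \<le> t (r, c)}"
  by (rule finite_subset[OF _ comp_tableau_finite_rows[of al t c]]) auto

lemma cnt_col_set_Suc_le:
  assumes "comp_tableau al t" "1 \<le> c" "1 \<le> x"
  shows "cnt (col_set t (Suc c)) x \<le> cnt (col_set t c) x"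
  unfolding cnt_col_set[OF assms(1,3)]
proof (rule card_mono)
  show "{r. x \<le> t (r, Suc c)} \<subseteq> {r. x \<le> t (r, c)}"
    using comp_tableauD(2)[OF assms(1,2)] by (auto intro: order_trans)
qed (rule comp_tableau_finite_ge[OF assms(1,3)])

section \<open>Chains of rows and one application of phi\<close>

section \<open>The operation phi\<close>

text \<open>The defining property of the row indices \<open>r\<^sub>1 > r\<^sub>2 > \<dots> > r\<^sub>k\<close> of the
operation phi, including the maximality of each \<open>r\<^sub>j\<close> and the stopping condition at \<open>r\<^sub>k\<close>.\<close>

fun is_chain :: "filling \<Rightarrow> nat \<Rightarrow> nat list \<Rightarrow> bool" where
  "is_chain t i [] \<longleftrightarrow> False"
| "is_chain t i [r] \<longleftrightarrow>
     1 \<le> r \<and> (\<forall>s. s < r \<and> t (r, i) < t (s, i) \<longrightarrow> t (r, i) < t (s, Suc i))"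
| "is_chain t i (r # r' # rs) \<longleftrightarrow>
     1 \<le> r' \<and> r' < r \<and> t (r, i) < t (r', i) \<and> t (r', Suc i) \<le> t (r, i) \<and>
     (\<forall>s. r' < s \<and> s < r \<and> t (r, i) < t (s, i) \<longrightarrow> t (r, i) < t (s, Suc i)) \<and>
     is_chain t i (r' # rs)"

lemma search_None:
  "search t i r m = None \<Longrightarrow> 1 \<le> s \<Longrightarrow> s \<le> m \<Longrightarrow> t (r, i) < t (s, i) \<Longrightarrow>
    t (r, i) < t (s, Suc i)"
  by (induction m) (auto split: if_splits simp: le_Suc_eq)

lemma search_Some:
  "search t i r m = Some r' \<Longrightarrow> 1 \<le> r' \<and> r' \<le> m \<and> t (r, i) < t (r', i) \<and>
    t (r', Suc i) \<le> t (r, i) \<and>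
    (\<forall>s. r' < s \<and> s \<le> m \<and> t (r, i) < t (s, i) \<longrightarrow> t (r, i) < t (s, Suc i))"
  by (induction m) (auto split: if_splits simp: le_Suc_eq)

lemma is_chain_chain:
  assumes "\<And>c. t (0, c) = 0" "1 \<le> r" "r \<le> n"
  shows "is_chain t i (chain t i n r) \<and> hd (chain t i n r) = r"
  using assms(2,3)
proof (induction n arbitrary: r)
  case (Suc n)
  show ?case
  proof (cases "search t i r (r - 1)")
    case None
    \<comment> \<open>\<open>search\<close> never inspects row 0, while \<open>is_chain\<close>
      quantifies over it; row 0 holds no entries.\<close>
    have "t (r, i) < t (s, Suc i)" if "s < r" "t (r, i) < t (s, i)" for s
      using search_None[OF None, of s] that assms(1)[of i] by (cases "s = 0") auto
    then show ?thesis using None Suc.prems by auto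
  next
    case (Some r')
    note s = search_Some[OF Some]
    have "is_chain t i (chain t i n r') \<and> hd (chain t i n r') = r'"
      using Suc s by (intro Suc.IH) auto
    then obtain rs where "chain t i n r' = r' # rs" "is_chain t i (r' # rs)"
      by (cases "chain t i n r'") auto
    then show ?thesis using Some s by auto
  qed
qed simp

text \<open>This is the loop of \<open>phi\<close> as a recursion along the chain. Values are read
  from the original \<open>t\<close>, so earlier writes do not interfere.\<close>

fun shift :: "filling \<Rightarrow> nat \<Rightarrow> nat list \<Rightarrow> filling \<Rightarrow> filling" where
  "shift t i (r # r' # rs) f = shift t i (r' # rs) (f((r', i) := t (r, i)))"
| "shift t i rs f = f"

lemma fold_shift:
  "fold (\<lambda>j f. f((rs ! Suc j, i) := t (rs ! j, i))) [0..<length rs - 1] f = shift t i rs f"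
proof (induction t i rs f rule: shift.induct)
  case (1 t i r r' rs f)
  have u: "[0..<length (r # r' # rs) - 1] = 0 # map Suc [0..<length (r' # rs) - 1]"
    by (simp add: upt_conv_Cons map_Suc_upt del: upt_Suc)
  from 1 show ?case
    by (simp only: u fold_simps fold_map o_def nth_Cons_Suc nth_Cons_0 shift.simps)
qed auto

lemma is_chain_mem:
  assumes "is_chain t i (r # rs)" "q \<in> set rs"
  shows "q < r" "t (r, i) < t (q, i)"
  using assms by (induction rs arbitrary: r) force+

lemma is_chain_le_last:
  "is_chain t i rs \<Longrightarrow> q \<in> set rs \<Longrightarrow> t (q, i) \<le> t (last rs, i)"
proof (induction t i rs arbitrary: q rule: is_chain.induct)
  case (3 t i r r' rs)
  then show ?case by fastforce
qed auto

lemma is_chain_below: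
  assumes "is_chain t i rs" "s < last rs" "t (last rs, i) < t (s, i)"
  shows "t (last rs, i) < t (s, Suc i)"
  using assms by (induction t i rs rule: is_chain.induct) auto

text \<open>Each chain row spans the half-open interval from its entry in column
  \<open>i + 1\<close> (excluded) to its entry in column \<open>i\<close> (included). Consecutive
  intervals leave no gap because \<open>t (r', Suc i)\<close> is at most
  \<open>t (r, i)\<close>.\<close>

lemma is_chain_witness:
  assumes "is_chain t i (r # rs)" "t (r, Suc i) < y" "y \<le> t (last (r # rs), i)"
  shows "\<exists>q. t (q, Suc i) < y \<and> y \<le> t (q, i)"
  using assms
proof (induction rs arbitrary: r)
  case (Cons r' rs)
  have r': "is_chain t i (r' # rs)" "t (r', Suc i) \<le> t (r, i)" using Cons.prems(1) by auto
  show ?case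
  proof (cases "y \<le> t (r, i)")
    case True
    then show ?thesis using Cons.prems(2) by blast
  next
    case False
    then show ?thesis using Cons.IH[OF r'(1)] r'(2) Cons.prems(3) by simp
  qed
qed auto

text \<open>The property passes from \<open>r\<close> to the next chain row \<open>r'\<close>. A row
  \<open>u\<close> violating it at \<open>r'\<close> would still satisfy
  \<open>t (r, i) < t (u, Suc i)\<close>, while the triple condition for \<open>r'\<close> and
  \<open>u\<close> would force \<open>t (u, Suc i) < t (r', Suc i)\<close>, which is at most
  \<open>t (r, i)\<close>.\<close>

lemma is_chain_above:
  assumes "comp_tableau al t" "1 \<le> i" "is_chain t i (r # rs)"
    and "\<And>s. r < s \<Longrightarrow> t (r, i) < t (s, i) \<Longrightarrow> t (r, i) < t (s, Suc i)"
    and "q \<in> set (r # rs)" "q < s" "t (q, i) < t (s, i)"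
  shows "t (q, i) < t (s, Suc i)"
  using assms(3-)
proof (induction rs arbitrary: r q s)
  case (Cons r' rs)
  have r': "r' < r" "t (r, i) < t (r', i)" "t (r', Suc i) \<le> t (r, i)"
    "\<And>s. r' < s \<Longrightarrow> s < r \<Longrightarrow> t (r, i) < t (s, i) \<Longrightarrow> t (r, i) < t (s, Suc i)"
    "is_chain t i (r' # rs)"
    using Cons.prems(1) by auto
  have above: "t (r', i) < t (u, Suc i)" if u: "r' < u" "t (r', i) < t (u, i)" for u
  proof (rule ccontr)
    assume "\<not> t (r', i) < t (u, Suc i)"
    then have le: "t (u, Suc i) \<le> t (r', i)" by simp
    have lt: "t (r, i) < t (u, i)" "u \<noteq> r" using r' u by auto
    then have "t (r, i) < t (u, Suc i)"
      using Cons.prems(2)[of u] r'(4)[of u] u by (meson nat_neq_iff)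
    then show False
      using comp_tableauD(4)[OF assms(1) u(1) assms(2) _ le] r'(3) by simp
  qed
  show ?case
  proof (cases "q = r")
    case True
    then show ?thesis using Cons.prems by simp
  next
    case False
    then show ?thesis using Cons.IH[OF r'(5) above] Cons.prems(3-5) by simp
  qed
qed simp

lemma shift_other:
  "q \<notin> set (tl rs) \<or> c \<noteq> i \<Longrightarrow> shift t i rs f (q, c) = f (q, c)"
  by (induction t i rs f rule: shift.induct) auto

text \<open>The witness is the predecessor of \<open>q\<close> in the chain. Entries grow along the
  chain, so it has the largest original entry among the chain rows of larger index; this settles
  triples with both rows on the chain.\<close>

lemma shift_mem:
  assumes "is_chain t i (r # rs)" "q \<in> set rs"
  shows "\<exists>q' \<in> set (r # rs). shift t i (r # rs) f (q, i) = t (q', i) \<and> q < q' \<and>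
    t (q', i) < t (q, i) \<and> t (q, Suc i) \<le> t (q', i) \<and>
    (\<forall>s. q < s \<and> s < q' \<and> t (q', i) < t (s, i) \<longrightarrow> t (q', i) < t (s, Suc i)) \<and>
    (\<forall>s \<in> set (r # rs). q < s \<longrightarrow> t (s, i) \<le> t (q', i))"
  using assms
proof (induction rs arbitrary: r f)
  case (Cons r' rs)
  have r': "r' < r" "t (r, i) < t (r', i)" "is_chain t i (r' # rs)"
    using Cons.prems(1) by auto
  show ?case
  proof (cases "q \<in> set rs")
    case False
    then have "q = r'" using Cons.prems by simp
    moreover have "shift t i (r' # rs) (f((r', i) := t (r, i))) (r', i) = t (r, i)"
      using False \<open>q = r'\<close> by (subst shift_other) auto
    ultimately show ?thesis
      using Cons.prems(1) is_chain_mem(1)[OF r'(3)] by (intro bexI[of _ r]) fastforce+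
  next
    case True
    obtain q' where q': "q' \<in> set (r' # rs)"
      "shift t i (r' # rs) (f((r', i) := t (r, i))) (q, i) = t (q', i)" "q < q'"
      "t (q', i) < t (q, i)" "t (q, Suc i) \<le> t (q', i)"
      "\<forall>s. q < s \<and> s < q' \<and> t (q', i) < t (s, i) \<longrightarrow> t (q', i) < t (s, Suc i)"
      "\<forall>s \<in> set (r' # rs). q < s \<longrightarrow> t (s, i) \<le> t (q', i)"
      using Cons.IH[OF r'(3) True] by blast
    have "t (r, i) \<le> t (q', i)"
      using q'(1) is_chain_mem(2)[OF Cons.prems(1), of q'] by auto
    then show ?thesis using q' by (intro bexI[of _ q']) auto
  qed
qed simp

lemma shift_covers:
  assumes "is_chain t i (r # rs)" "q \<in> set (r # rs)" "q \<noteq> last (r # rs)"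
  shows "\<exists>q'. shift t i (r # rs) f (q', i) = t (q, i)"
  using assms
proof (induction rs arbitrary: r f)
  case (Cons r' rs)
  have r': "is_chain t i (r' # rs)" using Cons.prems(1) by auto
  show ?case
  proof (cases "q = r")
    case True
    have "r' \<notin> set rs" using is_chain_mem(1)[OF r'] by blast
    then have "shift t i (r' # rs) (f((r', i) := t (r, i))) (r', i) = t (r, i)"
      by (subst shift_other) auto
    then show ?thesis using True by auto
  next
    case False
    then show ?thesis using Cons.IH[OF r'] Cons.prems by auto
  qed
qed simp

text \<open>Here \<open>r\<close> plays the role of r_1. Its maximality is encoded by
  \<open>lowest\<close>: no row of larger index ends exactly in column \<open>i\<close>.\<close>

locale exit_path =
  fixes al :: "nat list" and t :: filling and i r :: nat and rs :: "nat list"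
  assumes ct: "comp_tableau al t" and i: "1 \<le> i" and chain: "is_chain t i (r # rs)"
    and row: "1 \<le> r" "r \<le> length al" "al ! (r - 1) = i"
    and lowest: "\<And>s. r < s \<Longrightarrow> t (s, i) \<noteq> 0 \<Longrightarrow> t (s, Suc i) \<noteq> 0"
begin

text \<open>This is the filling before an emptied row is deleted, which matters only for
  \<open>i = 1\<close>.\<close>

definition "t1 = shift t i (r # rs) (t((r, i) := 0))"

definition "ex = t (last (r # rs), i)"

lemma row_end: "t (r, i) \<noteq> 0" "t (r, Suc i) = 0"
  using comp_tableauD(1)[OF ct, of r i] comp_tableauD(1)[OF ct, of r "Suc i"] row i by (auto simp: cboxes_def)

text \<open>By \<open>lowest\<close> row \<open>s\<close> continues into column
  \<open>i + 1\<close>. Were its entry there at most \<open>t (r, i)\<close>, the triple condition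
  would put it below \<open>t (r, Suc i) = 0\<close>.\<close>

lemma above_start: "t (r, i) < t (s, Suc i)" if "r < s" "t (r, i) < t (s, i)" for s
  using comp_tableauD(4)[OF ct that(1) i] lowest[OF that(1)] that row_end by (metis not_le not_less_zero)

lemma above:
  "q \<in> set (r # rs) \<Longrightarrow> q < s \<Longrightarrow> t (q, i) < t (s, i) \<Longrightarrow> t (q, i) < t (s, Suc i)"
  using is_chain_above[OF ct i chain above_start] by blast

text \<open>Rows after r_k are covered by \<open>above\<close>, rows before r_k by the stopping
  condition of the chain.\<close>

lemma ex_lt: "ex < t (s, i) \<Longrightarrow> ex < t (s, Suc i)"
  using above[of "last (r # rs)" s] is_chain_below[OF chain, of s]
  unfolding ex_def by (metis last_in_set list.distinct(1) nat_neq_iff)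

lemma mem_ge: "q \<in> set (r # rs) \<Longrightarrow> t (r, i) \<le> t (q, i)"
  using is_chain_mem(2)[OF chain] by fastforce

lemma mem_le_ex: "q \<in> set (r # rs) \<Longrightarrow> t (q, i) \<le> ex"
  unfolding ex_def by (rule is_chain_le_last[OF chain])

lemma t1_col: "c \<noteq> i \<Longrightarrow> t1 (q, c) = t (q, c)"
  unfolding t1_def by (subst shift_other) auto

lemma t1_notin: "q \<notin> set (r # rs) \<Longrightarrow> t1 (q, i) = t (q, i)"
  unfolding t1_def by (subst shift_other) auto

lemma t1_start: "t1 (r, i) = 0"
proof -
  have "r \<notin> set rs" using is_chain_mem(1)[OF chain] by blast
  then show ?thesis unfolding t1_def by (subst shift_other) auto
qed

lemma t1_mem:
  assumes "q \<in> set (r # rs)" "q \<noteq> r"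
  obtains q' where "q' \<in> set (r # rs)" "t1 (q, i) = t (q', i)" "q < q'"
    "t (q', i) < t (q, i)" "t (q, Suc i) \<le> t (q', i)"
    "\<And>s. q < s \<Longrightarrow> s < q' \<Longrightarrow> t (q', i) < t (s, i) \<Longrightarrow> t (q', i) < t (s, Suc i)"
    "\<And>s. s \<in> set (r # rs) \<Longrightarrow> q < s \<Longrightarrow> t (s, i) \<le> t (q', i)"
proof -
  have "q \<in> set rs" using assms by simp
  from shift_mem[OF chain this, of "t((r, i) := 0)"] show ?thesis
    unfolding t1_def[symmetric] using that by blast
qed

lemma t1_le: "t1 (q, i) \<le> t (q, i)"
proof (cases "q \<in> set (r # rs) \<and> q \<noteq> r")
  case True
  then show ?thesis by (metis t1_mem less_imp_le)
next
  case False
  then show ?thesis using t1_notin t1_start by (cases "q = r") auto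
qed

lemma t1_mem_less: "q \<in> set (r # rs) \<Longrightarrow> t1 (q, i) < t (q, i)"
  using t1_start row_end(1) by (cases "q = r") (simp, metis t1_mem)

lemma t1_ge: "t (q, Suc i) \<le> t1 (q, i)"
proof (cases "q \<in> set (r # rs) \<and> q \<noteq> r")
  case True
  then show ?thesis by (metis t1_mem)
next
  case False
  then show ?thesis
    using t1_notin[of q] t1_start row_end comp_tableauD(2)[OF ct i, of q] by (cases "q = r") auto
qed

lemma t1_eq_0: "t1 (q, c) \<noteq> 0 \<longleftrightarrow> t (q, c) \<noteq> 0 \<and> (q, c) \<noteq> (r, i)"
proof (cases "c = i")
  case False
  then show ?thesis using t1_col by auto
next
  case True
  show ?thesis
  proof (cases "q \<in> set (r # rs) \<and> q \<noteq> r")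
    case mem: True
    then obtain q' where "q' \<in> set (r # rs)" "t1 (q, i) = t (q', i)" "t (q', i) < t (q, i)"
      by (metis t1_mem)
    then show ?thesis using mem_ge[of q'] row_end True mem by auto
  next
    case False
    then show ?thesis using True t1_start t1_notin by (cases "q = r") auto
  qed
qed

text \<open>If the entry \<open>t (q', i)\<close> moved into row \<open>q\<close> were not larger,
  it would be smaller than \<open>t (s, i)\<close> and hence than \<open>t (s, Suc i)\<close>. The
  triple condition for \<open>q\<close> and \<open>s\<close> would then give
  \<open>t (s, Suc i) < t (q, Suc i)\<close>, which is at most \<open>t (q', i)\<close>.\<close>

lemma t1_less:
  assumes q: "q \<in> set (r # rs)" "q < s" and s: "s \<notin> set (r # rs)" "t (s, i) \<noteq> 0"
    and less: "t (s, i) < t (q, i)"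
  shows "t (s, i) < t1 (q, i)"
proof (cases "q = r")
  case True
  \<comment> \<open>This case is contradictory: row \<open>s\<close> has an entry in column
    \<open>i + 1\<close>, and the triple condition would put it below
    \<open>t (r, Suc i) = 0\<close>.\<close>
  then show ?thesis
    using lowest[of s] comp_tableauD(4)[OF ct q(2) i] comp_tableauD(2)[OF ct i, of s] row_end q s less by auto
next
  case False
  with q obtain q' where q': "q' \<in> set (r # rs)" "t1 (q, i) = t (q', i)" "q < q'"
    "t (q, Suc i) \<le> t (q', i)"
    "\<And>s. q < s \<Longrightarrow> s < q' \<Longrightarrow> t (q', i) < t (s, i) \<Longrightarrow> t (q', i) < t (s, Suc i)"
    by (metis t1_mem)
  show ?thesis
  proof (rule ccontr)
    assume "\<not> ?thesis"
    moreover have "s \<noteq> q'" using s q' by auto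
    ultimately have gt: "t (q', i) < t (s, i)"
      using comp_tableau_inj[OF ct s(2), of q'] q' by (metis le_neq_implies_less not_le)
    have "t (q', i) < t (s, Suc i)"
      using q'(5)[OF q(2)] above[OF q'(1)] gt \<open>s \<noteq> q'\<close> by (metis nat_neq_iff)
    moreover have "t (s, Suc i) \<le> t (q, i)"
      using comp_tableauD(2)[OF ct i, of s] less by simp
    ultimately show False using comp_tableauD(4)[OF ct q(2) i] q'(4) by (metis leD le_trans less_or_eq_imp_le not_less_zero)
  qed
qed

lemma comp_tableau_t1: "comp_tableau (al[r - 1 := i - 1]) t1"
  unfolding comp_tableau_def
proof (intro conjI allI impI)
  have "cboxes (al[r - 1 := i - 1]) = cboxes al - {(r, i)}"
    using row i by (auto simp: cboxes_def nth_list_update split: if_splits)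
  then show "t1 (q, c) \<noteq> 0 \<longleftrightarrow> (q, c) \<in> cboxes (al[r - 1 := i - 1])" for q c
    using t1_eq_0[of q c] comp_tableauD(1)[OF ct, of q c] by auto
next
  show "t1 (q, Suc c) \<le> t1 (q, c)" if "1 \<le> c" for q c
    using t1_ge[of q] t1_le[of q] comp_tableauD(2)[OF ct that, of q] t1_col[of _ q] that
    by (cases "c = i"; cases "Suc c = i") auto
next
  fix q s assume a: "q < s \<and> t1 (q, 1) \<noteq> 0 \<and> t1 (s, 1) \<noteq> 0"
  then have lt: "t (q, 1) < t (s, 1)"
    using comp_tableauD(3)[OF ct, of q s] t1_eq_0 by metis
  show "t1 (q, 1) < t1 (s, 1)"
  proof (cases "i = 1")
    case False
    then show ?thesis using lt t1_col by simp
  next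
    case True
    \<comment> \<open>The first column increases strictly downwards, so no earlier row has a larger
      entry and the chain stops at once.\<close>
    have "rs = []"
    proof (cases rs)
      case (Cons r' rs')
      then show ?thesis
        using chain True comp_tableauD(3)[OF ct, of r' r] row_end by auto
    qed
    then have "s \<notin> set (r # rs)" using a t1_start True by auto
    then show ?thesis using lt t1_notin[of s] t1_le[of q] True by simp
  qed
next
  fix q s c assume a: "q < s \<and> 1 \<le> c \<and> t1 (s, Suc c) \<noteq> 0 \<and> t1 (s, Suc c) \<le> t1 (q, c)"
  note tr = comp_tableauD(4)[OF ct, of q s c]
  \<comment> \<open>Only column \<open>i\<close> changes. As the left column of a triple it merely
    shrinks, which strengthens the premise; the work is in the case where it is the right
    column.\<close>
  consider "c = i" | "Suc c = i" | "c \<noteq> i" "Suc c \<noteq> i" by blast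
  then show "t1 (s, Suc c) < t1 (q, Suc c)"
  proof cases
    case 1
    then show ?thesis using a tr t1_col[of "Suc i"] t1_le[of q] by simp
  next
    case 3
    then show ?thesis using a tr t1_col by simp
  next
    case 2
    then have q: "t1 (q, c) = t (q, c)" using t1_col[of c q] by simp
    show ?thesis
    proof (cases "s \<in> set (r # rs)")
      case False
      then have s: "t1 (s, i) = t (s, i)" by (rule t1_notin)
      then have "t (s, i) < t (q, i)" using a tr 2 q by simp
      then show ?thesis
        using t1_less[of q s] t1_notin[of q] False a s 2 by (cases "q \<in> set (r # rs)") auto
    next
      case True
      moreover have "s \<noteq> r" using a t1_start 2 by auto
      ultimately obtain s' where s': "s' \<in> set (r # rs)" "t1 (s, i) = t (s', i)" "s < s'"
        by (metis t1_mem)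
      \<comment> \<open>The new entry of row \<open>s\<close> came from row \<open>s'\<close>
        further down, so the old triple condition is applied to \<open>q\<close> and
        \<open>s'\<close>.\<close>
      have "t (s', i) < t (q, i)"
        using comp_tableauD(4)[OF ct, of q s' c] a s' 2 q by auto
      moreover have "t1 (s, i) < t1 (q, i)" if qm: "q \<in> set (r # rs)"
      proof -
        have "s' \<le> r" using s'(1) is_chain_mem(1)[OF chain] by fastforce
        then have "q \<noteq> r" using a s' by simp
        with qm obtain q' where "t1 (q, i) = t (q', i)"
          "\<And>s. s \<in> set (r # rs) \<Longrightarrow> q < s \<Longrightarrow> t (s, i) \<le> t (q', i)"
          by (metis t1_mem)
        then show ?thesis using True a t1_mem_less[OF True] by fastforce
      qed
      ultimately show ?thesis using s' 2 t1_notin[of q] by (cases "q \<in> set (r # rs)") auto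
    qed
  qed
qed

lemma ex_mem: "last (r # rs) \<in> set (r # rs)"
  by (rule last_in_set) simp

lemma ex_pos: "1 \<le> ex"
  using mem_ge[OF ex_mem] row_end(1) unfolding ex_def by simp

text \<open>By \<open>ex_lt\<close>, exactly one row, r_k, reaches \<open>ex\<close> in column
  \<open>i\<close> without reaching it in column \<open>i + 1\<close>; for smaller thresholds the
  chain still supplies such a row.\<close>

lemma ex_exits: "exits (col_set t i) (col_set t (Suc i)) ex"
proof -
  have b: "t (last (r # rs), Suc i) < ex"
    using t1_ge[of "last (r # rs)"] t1_mem_less[OF ex_mem] unfolding ex_def by simp
  have ge: "ex \<le> t (s, i) \<Longrightarrow> s \<noteq> last (r # rs) \<Longrightarrow> ex < t (s, Suc i)" for s
    using ex_lt[of s] comp_tableau_inj[OF ct, of "last (r # rs)" i s] ex_pos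
    unfolding ex_def by (metis le_neq_implies_less not_one_le_zero)
  have mem: "ex \<in> col_set t i" using ex_pos unfolding ex_def col_set_iff by auto
  \<comment> \<open>A row with \<open>ex\<close> in column \<open>i + 1\<close> differs from r_k and
    reaches \<open>ex\<close> in column \<open>i\<close>, so its entry in column
    \<open>i + 1\<close> would have to exceed \<open>ex\<close>.\<close>
  have "t (s, Suc i) \<noteq> ex" for s
  proof
    assume s: "t (s, Suc i) = ex"
    then have "s \<noteq> last (r # rs)" using b by auto
    then show False using ge[of s] comp_tableauD(2)[OF ct i, of s] s by simp
  qed
  then have notin: "ex \<notin> col_set t (Suc i)" by (simp add: col_set_iff)
  have "{s. ex \<le> t (s, i)} = insert (last (r # rs)) {s. ex \<le> t (s, Suc i)}"
    using ge comp_tableauD(2)[OF ct i] by (auto simp: ex_def intro: order_trans less_imp_le)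
  then have eq: "cnt (col_set t i) ex = Suc (cnt (col_set t (Suc i)) ex)"
    using b comp_tableau_finite_ge[OF ct ex_pos] by (simp add: cnt_col_set[OF ct ex_pos])
  have less: "cnt (col_set t (Suc i)) y < cnt (col_set t i) y" if y: "1 \<le> y" "y \<le> ex" for y
    unfolding cnt_col_set[OF ct y(1)]
  proof (rule psubset_card_mono[OF comp_tableau_finite_ge[OF ct y(1)]])
    \<comment> \<open>The chain starts with \<open>t (r, Suc i) = 0 < y\<close>, so its intervals
      cover \<open>y\<close>; the row found counts in column \<open>i\<close> only.\<close>
    obtain q where q: "t (q, Suc i) < y" "y \<le> t (q, i)"
      using is_chain_witness[OF chain _ y(2)[unfolded ex_def]] row_end y(1) by auto
    have "{s. y \<le> t (s, Suc i)} \<subseteq> {s. y \<le> t (s, i)}"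
      using comp_tableauD(2)[OF ct i] by (auto intro: order_trans)
    moreover have "q \<notin> {s. y \<le> t (s, Suc i)}" "q \<in> {s. y \<le> t (s, i)}"
      using q by simp_all
    ultimately show "{s. y \<le> t (s, Suc i)} \<subset> {s. y \<le> t (s, i)}"
      by blast
  qed
  show ?thesis unfolding exits_def using mem notin eq less by blast
qed

text \<open>Every chain entry but the last survives in the next chain row, and by distinctness
  \<open>ex\<close> occurs in no other row.\<close>

lemma col_set_t1: "col_set t1 i = col_set t i - {ex}"
proof (intro equalityI subsetI)
  fix y assume "y \<in> col_set t1 i"
  then obtain q where q: "y = t1 (q, i)" "y \<noteq> 0" by (auto simp: col_set_iff)
  show "y \<in> col_set t i - {ex}"
  proof (cases "q \<in> set (r # rs)")
    case True
    then have "y \<noteq> ex" using t1_mem_less[of q] mem_le_ex[of q] q by auto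
    moreover have "q \<noteq> r" using q t1_start by auto
    then obtain q' where "t1 (q, i) = t (q', i)" using True by (metis t1_mem)
    ultimately show ?thesis using q by (auto simp: col_set_iff)
  next
    case False
    then have "y = t (q, i)" using q t1_notin by simp
    moreover have "q \<noteq> last (r # rs)" using False ex_mem by auto
    ultimately show ?thesis
      using q comp_tableau_inj[OF ct, of q i "last (r # rs)"] by (auto simp: col_set_iff ex_def)
  qed
next
  fix y assume "y \<in> col_set t i - {ex}"
  then obtain q where q: "y = t (q, i)" "y \<noteq> 0" "y \<noteq> ex" by (auto simp: col_set_iff)
  have "\<exists>q'. t1 (q', i) = y"
  proof (cases "q \<in> set (r # rs)")
    case True
    moreover have "q \<noteq> last (r # rs)" using q ex_def by metis
    ultimately show ?thesis using shift_covers[OF chain] q unfolding t1_def by metis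
  next
    case False
    then show ?thesis using q t1_notin by metis
  qed
  then show "y \<in> col_set t1 i" using q by (simp add: col_set_iff)
qed

text \<open>This will be the triple condition between an old row and the appended last row, which
  holds \<open>ex\<close> in column \<open>i + 1\<close>. The premise may be weak because
  \<open>ex\<close> has left column \<open>i\<close>.\<close>

lemma ex_rows: "ex \<le> t1 (s, i) \<Longrightarrow> ex < t1 (s, Suc i)"
proof -
  assume a: "ex \<le> t1 (s, i)"
  have "s \<notin> set (r # rs)" using t1_mem_less[of s] mem_le_ex[of s] a by force
  moreover from this have "s \<noteq> last (r # rs)" using ex_mem by blast
  ultimately have "ex < t (s, i)"
    using a t1_notin[of s] comp_tableau_inj[OF ct, of "last (r # rs)" i s] ex_pos
    unfolding ex_def by (metis le_neq_implies_less not_one_le_zero)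
  then show ?thesis using ex_lt t1_col[of "Suc i" s] by simp
qed

end

section \<open>Deletion of an emptied row and the composition of the operations phi\<close>

lemma comp_tableau_reindex:
  assumes "comp_tableau al t" "\<And>q s. q < s \<Longrightarrow> f q < f s"
    and "\<And>s c. (s, c) \<in> cboxes al' \<longleftrightarrow> (f s, c) \<in> cboxes al"
    and "\<And>s c. t' (s, c) = t (f s, c)"
  shows "comp_tableau al' t'"
  unfolding comp_tableau_def
proof (intro conjI allI impI)
  show "t' (r, c) \<noteq> 0 \<longleftrightarrow> (r, c) \<in> cboxes al'" for r c
    unfolding assms(3,4) by (rule comp_tableauD(1)[OF assms(1)])
  show "t' (r, Suc c) \<le> t' (r, c)" if "1 \<le> c" for r c
    unfolding assms(4) by (rule comp_tableauD(2)[OF assms(1) that])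
  show "t' (r, 1) < t' (s, 1)" if "r < s \<and> t' (r, 1) \<noteq> 0 \<and> t' (s, 1) \<noteq> 0" for r s
    using that comp_tableauD(3)[OF assms(1) assms(2)] unfolding assms(4) by blast
  show "t' (s, Suc c) < t' (r, Suc c)"
    if "r < s \<and> 1 \<le> c \<and> t' (s, Suc c) \<noteq> 0 \<and> t' (s, Suc c) \<le> t' (r, c)" for r s c
    using that comp_tableauD(4)[OF assms(1) assms(2)] unfolding assms(4) by blast
qed

lemma cboxes_delete_row:
  assumes "1 \<le> r" "r \<le> length al"
  shows "(s, c) \<in> cboxes (take (r - 1) al @ drop r al) \<longleftrightarrow>
    ((if s < r then s else Suc s), c) \<in> cboxes (al[r - 1 := 0])"
proof (cases "s < r")
  case True
  then show ?thesis using assms by (auto simp: cboxes_def nth_append)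
next
  case False
  then have "s - Suc 0 - (r - 1) + r = s" "s \<noteq> r - 1" using assms by auto
  then show ?thesis
    using assms False by (auto simp: cboxes_def nth_append add.commute)
qed

text \<open>The part \<open>i - 1\<close> created here makes the next operation applicable. The map
  \<open>f\<close> records the renumbering of rows when a row is deleted; columns to the right of
  \<open>i\<close> are otherwise untouched.\<close>

lemma phi_step:
  assumes "comp_tableau al t" "is_composition al" "1 \<le> i" "i \<in> set al"
  obtains al' t' e f where "phi (Suc i) (al, t) = Some ((al', t'), e)"
    "is_composition al'" "comp_tableau al' t'" "2 \<le> i \<Longrightarrow> i - 1 \<in> set al'"
    "\<And>c. col_set t' c = (if c = i then col_set t i - {e} else col_set t c)"
    "exits (col_set t i) (col_set t (Suc i)) e"
    "\<And>s. e \<le> t' (s, i) \<Longrightarrow> e < t' (s, Suc i)"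
    "\<And>s c. i < c \<Longrightarrow> t' (s, c) = t (f s, c)"
proof -
  let ?R = "{r. 1 \<le> r \<and> r \<le> length al \<and> al ! (r - 1) = i}"
  define r where "r = Max ?R"
  obtain j where "j < length al" "al ! j = i" using assms(4) by (auto simp: in_set_conv_nth)
  then have "Suc j \<in> ?R" by simp
  then have r_mem: "r \<in> ?R" unfolding r_def by (intro Max_in) auto
  then have row: "1 \<le> r" "r \<le> length al" "al ! (r - 1) = i" by auto
  have r_max: "s \<le> r" if "s \<in> ?R" for s
    unfolding r_def using that by (intro Max_ge) auto
  have "\<And>c. t (0, c) = 0"
    using comp_tableauD(1)[OF assms(1), of 0] by (auto simp: cboxes_def)
  then have ch: "is_chain t i (chain t i r r)" "hd (chain t i r r) = r"
    using is_chain_chain[of t r r i] row by auto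
  then obtain rs where rs: "chain t i r r = r # rs" by (cases "chain t i r r") auto
  interpret exit_path al t i r rs
  proof
    show "t (s, Suc i) \<noteq> 0" if "r < s" "t (s, i) \<noteq> 0" for s
      using r_max[of s] that comp_tableauD(1)[OF assms(1), of s i] comp_tableauD(1)[OF assms(1), of s "Suc i"]
      by (auto simp: cboxes_def)
  qed (use assms row ch rs in auto)
  have phi: "phi (Suc i) (al, t) = (if i = 1
        then Some ((take (r - 1) al @ drop r al,
                    \<lambda>(s, c). if s < r then t1 (s, c) else t1 (Suc s, c)), ex)
        else Some ((al[r - 1 := i - 1], t1), ex))"
    unfolding phi_def Let_def fst_conv snd_conv diff_Suc_1 r_def[symmetric] rs fold_shift
      t1_def[symmetric] ex_def[symmetric]
    using assms by simp
  have cols: "col_set t1 c = (if c = i then col_set t i - {ex} else col_set t c)" for c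
  proof (cases "c = i")
    case False
    then show ?thesis using t1_col by (intro set_eqI) (simp add: col_set_iff)
  qed (simp add: col_set_t1)
  show ?thesis
  proof (cases "i = 1")
    case False
    show ?thesis
    proof (rule that)
      show "phi (Suc i) (al, t) = Some ((al[r - 1 := i - 1], t1), ex)"
        using phi False by simp
      show "is_composition (al[r - 1 := i - 1])"
        unfolding is_composition_def
      proof
        fix x assume "x \<in> set (al[r - 1 := i - 1])"
        then have "x = i - 1 \<or> x \<in> set al"
          using set_update_subset_insert[of al "r - 1" "i - 1"] by blast
        then show "0 < x" using assms(2,3) False by (auto simp: is_composition_def)
      qed
      show "i - 1 \<in> set (al[r - 1 := i - 1])" using row by (intro set_update_memI) simp
      show "t1 (s, c) = t (id s, c)" if "i < c" for s c using t1_col that by simp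
    qed (use comp_tableau_t1 cols ex_exits ex_rows in auto)
  next
    case True
    define f where "f = (\<lambda>s. if s < r then s else Suc s)"
    define t' where "t' = (\<lambda>(s, c). if s < r then t1 (s, c) else t1 (Suc s, c))"
    let ?al = "take (r - 1) al @ drop r al"
    have t': "t' (s, c) = t1 (f s, c)" for s c by (simp add: t'_def f_def)
    \<comment> \<open>The deleted row is empty, so skipping its index loses no entry from any column
      set.\<close>
    have range: "\<exists>s. q = f s" if "t1 (q, c) \<noteq> 0" for q c
    proof -
      have "(q, c) \<in> cboxes (al[r - 1 := i - 1])" using comp_tableauD(1)[OF comp_tableau_t1] that by blast
      then have "q \<noteq> r" using True row by (auto simp: cboxes_def)
      then have "q = f (if q < r then q else q - 1)" by (auto simp: f_def)
      then show ?thesis by blast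
    qed
    show ?thesis
    proof (rule that)
      show "phi (Suc i) (al, t) = Some ((?al, t'), ex)"
        using phi True by (simp add: t'_def)
      show "is_composition ?al"
        using assms(2) by (auto simp: is_composition_def dest: in_set_takeD in_set_dropD)
      show "comp_tableau ?al t'"
      proof (rule comp_tableau_reindex[OF comp_tableau_t1])
        show "(s, c) \<in> cboxes ?al \<longleftrightarrow> (f s, c) \<in> cboxes (al[r - 1 := i - 1])" for s c
          using cboxes_delete_row[OF row(1,2)] True by (simp add: f_def)
        show "f q < f s" if "q < s" for q s using that by (simp add: f_def)
      qed (rule t')
      show "col_set t' c = (if c = i then col_set t i - {ex} else col_set t c)" for c
      proof -
        have "col_set t' c = col_set t1 c"
          unfolding set_eq_iff col_set_iff t' using range by metis
        then show ?thesis using cols by simp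
      qed
      show "t' (s, c) = t (f s, c)" if "i < c" for s c using t1_col that t' by simp
      show "ex < t' (s, Suc i)" if "ex \<le> t' (s, i)" for s
        using that ex_rows unfolding t' by blast
    qed (use True ex_exits in auto)
  qed
qed

text \<open>The entry \<open>e q\<close> leaves column \<open>q - 1\<close> under phi_q. Since phi_k
  acts first, the exits are listed with decreasing index, and column \<open>q\<close> has already
  lost \<open>e (Suc q)\<close> when phi_q acts.\<close>

lemma phis_spec:
  assumes "comp_tableau al t" "is_composition al" "1 \<le> k" "k = 1 \<or> k - 1 \<in> set al"
  shows "\<exists>ga t' e f. phis k (al, t) = Some ((ga, t'), map e (rev [2..<Suc k])) \<and>
    is_composition ga \<and> comp_tableau ga t' \<and>
    (\<forall>c. col_set t' c = (if 1 \<le> c \<and> c < k then col_set t c - {e (Suc c)} else col_set t c)) \<and>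
    (\<forall>q. 2 \<le> q \<and> q \<le> k \<longrightarrow>
      exits (col_set t (q - 1)) (if q = k then col_set t k else col_set t q - {e (Suc q)}) (e q) \<and>
      (\<forall>s. e q \<le> t' (s, q - 1) \<longrightarrow> e q < t' (s, q))) \<and>
    (\<forall>s c. k \<le> c \<longrightarrow> t' (s, c) = t (f s, c))"
  using assms
proof (induction k arbitrary: al t)
  case (Suc k)
  show ?case
  proof (cases "k = 0")
    case True
    then show ?thesis using Suc.prems
      by (intro exI[of _ al] exI[of _ t] exI[of _ id]) (subst phis.simps, auto)
  next
    case False
    then have k: "1 \<le> k" "k \<in> set al" using Suc.prems(4) by auto
    obtain al1 t1 e1 f1 where phi: "phi (Suc k) (al, t) = Some ((al1, t1), e1)"
      "is_composition al1" "comp_tableau al1 t1" "2 \<le> k \<Longrightarrow> k - 1 \<in> set al1"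
      "\<And>c. col_set t1 c = (if c = k then col_set t k - {e1} else col_set t c)"
      "exits (col_set t k) (col_set t (Suc k)) e1"
      "\<And>s. e1 \<le> t1 (s, k) \<Longrightarrow> e1 < t1 (s, Suc k)"
      "\<And>s c. k < c \<Longrightarrow> t1 (s, c) = t (f1 s, c)"
      using phi_step[OF Suc.prems(1,2) k] by metis
    have "k = 1 \<or> k - 1 \<in> set al1" using phi(4) k by force
    from Suc.IH[OF phi(3,2) k(1) this] obtain ga t' e f where
      IH: "phis k (al1, t1) = Some ((ga, t'), map e (rev [2..<Suc k]))"
      "is_composition ga" "comp_tableau ga t'" and
      cols: "\<forall>c. col_set t' c =
        (if 1 \<le> c \<and> c < k then col_set t1 c - {e (Suc c)} else col_set t1 c)" and
      ex: "\<forall>q. 2 \<le> q \<and> q \<le> k \<longrightarrow>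
        exits (col_set t1 (q - 1)) (if q = k then col_set t1 k else col_set t1 q - {e (Suc q)}) (e q) \<and>
        (\<forall>s. e q \<le> t' (s, q - 1) \<longrightarrow> e q < t' (s, q))" and
      index: "\<forall>s c. k \<le> c \<longrightarrow> t' (s, c) = t1 (f s, c)"
      by (elim exE conjE) (rule that; assumption)
    define e' where "e' = e(Suc k := e1)"
    have e': "e' q = e q" if "q \<le> k" for q using that by (simp add: e'_def)
    show ?thesis
    proof (rule exI[of _ ga], rule exI[of _ t'], rule exI[of _ e'], rule exI[of _ "f1 \<circ> f"],
        intro conjI allI impI)
      have "map e' (rev [2..<Suc k]) = map e (rev [2..<Suc k])" using e' by auto
      then have "map e' (rev [2..<Suc (Suc k)]) = e1 # map e (rev [2..<Suc k])"
        using k(1) by (simp add: e'_def)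
      then show "phis (Suc k) (al, t) = Some ((ga, t'), map e' (rev [2..<Suc (Suc k)]))"
        using k(1) phi(1) IH(1) by (subst phis.simps) (simp del: upt_Suc phis.simps)
      show "col_set t' c = (if 1 \<le> c \<and> c < Suc k then col_set t c - {e' (Suc c)} else col_set t c)"
        for c
        using cols[rule_format, of c] phi(5)[of c] k(1) by (auto simp: e'_def)
      show "exits (col_set t (q - 1))
        (if q = Suc k then col_set t (Suc k) else col_set t q - {e' (Suc q)}) (e' q)"
        if q: "2 \<le> q \<and> q \<le> Suc k" for q
      proof (cases "q = Suc k")
        case True
        then show ?thesis using phi(6) by (simp add: e'_def)
      next
        case False
        then have "q - 1 \<noteq> k" using q by auto
        then show ?thesis
          using ex[rule_format, of q] False q phi(5)[of "q - 1"] phi(5)[of q]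
          by (cases "q = k") (auto simp: e'_def)
      qed
      show "e' q < t' (s, q)" if q: "2 \<le> q \<and> q \<le> Suc k" "e' q \<le> t' (s, q - 1)" for q s
      proof (cases "q = Suc k")
        case True
        \<comment> \<open>Later operations only renumber rows in columns \<open>k\<close> and
          \<open>k + 1\<close>, by the same map, so the row property of the first exit
          persists.\<close>
        then show ?thesis
          using q phi(7)[of "f s"] index[rule_format, of k s] index[rule_format, of "Suc k" s] by (simp add: e'_def)
      next
        case False
        then show ?thesis using ex[rule_format, of q] q by (simp add: e'_def)
      qed
      show "t' (s, c) = t ((f1 \<circ> f) s, c)" if "Suc k \<le> c" for s c
        using index[rule_format, of c s] phi(8)[of c "f s"] that by simp
    qed (fact IH)+
  qed
qed simp

section \<open>The appended last row and the column sets seen by rho\<close>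

section \<open>The last row and the map rho\<close>

lemma cnt_Suc:
  assumes "finite S"
  shows "cnt S e = cnt S (Suc e) + (if e \<in> S then 1 else 0)"
proof -
  have "{y \<in> S. e \<le> y} = (if e \<in> S then insert e {y \<in> S. Suc e \<le> y} else {y \<in> S. Suc e \<le> y})"
    by (auto simp: Suc_le_eq le_less)
  then show ?thesis using assms by (simp add: cnt_def)
qed

text \<open>If \<open>x\<close> exceeded \<open>e\<close>, then at threshold \<open>e + 1\<close>
  the sets \<open>A\<close> and \<open>B - {x}\<close> would have equal counts, and putting
  \<open>x\<close> back would make \<open>B\<close> exceed \<open>A\<close>. This orders the exiting
  entries.\<close>

lemma exits_mono:
  assumes "finite A" "finite B" "exits A (B - {x}) e" "x \<in> B"
    and "\<And>y. 1 \<le> y \<Longrightarrow> cnt B y \<le> cnt A y"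
  shows "x \<le> e"
proof (rule ccontr)
  assume "\<not> x \<le> e"
  then have "cnt B (Suc e) = Suc (cnt (B - {x}) (Suc e))"
    using cnt_insert[of "B - {x}" x "Suc e"] assms by (simp add: insert_absorb)
  moreover have "cnt A (Suc e) = cnt (B - {x}) (Suc e)"
    using assms(1-3) cnt_Suc[of A e] cnt_Suc[of "B - {x}" e] by (auto simp: exits_def)
  ultimately show False using assms(5)[of "Suc e"] by simp
qed

lemma concat_if_singleton:
  "concat (map (\<lambda>r. if P r then [g r] else []) xs) = map g (filter P xs)"
  by (induction xs) auto

text \<open>Column entries are distinct, so sorting the list agrees with listing the set. Truncated
  subtraction sends the rows of the inner shape to row 0 of \<open>desc\<close>, which is
  empty.\<close>

lemma rho_desc:
  assumes "SSRCT al be t"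
  shows "rho be al t (r, c) = desc (col_set t c) (r - length (filter (\<lambda>x. c \<le> x) be))"
proof -
  define xs where "xs = filter (\<lambda>r. (r, c) \<in> skew_boxes al be) [1..<Suc (length al)]"
  have ce: "col_entries be al t c = map (\<lambda>r. t (r, c)) xs"
    by (simp add: col_entries_def concat_if_singleton xs_def del: upt_Suc)
  have sub: "(r, c) \<in> skew_boxes al be \<Longrightarrow> 1 \<le> r \<and> r \<le> length al \<and> 1 \<le> c" for r
    by (auto simp: skew_boxes_def cboxes_def)
  have "inj_on (\<lambda>r. t (r, c)) (set xs)"
    using SSRCT_inj[OF assms] by (auto simp: inj_on_def xs_def)
  then have dist: "distinct (col_entries be al t c)"
    unfolding ce by (simp add: distinct_map xs_def)
  have set: "set (col_entries be al t c) = col_set t c"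
  proof (intro set_eqI)
    fix y
    have "y \<in> set (col_entries be al t c) \<longleftrightarrow> (\<exists>r. (r, c) \<in> skew_boxes al be \<and> t (r, c) = y)"
      unfolding ce xs_def using sub by (auto simp: image_iff less_Suc_eq_le simp del: upt_Suc)
    also have "\<dots> \<longleftrightarrow> y \<in> col_set t c"
      unfolding col_set_iff SSRCT_D(1)[OF assms, symmetric] by auto
    finally show "y \<in> set (col_entries be al t c) \<longleftrightarrow> y \<in> col_set t c" .
  qed
  have L: "sort (col_entries be al t c) = sorted_list_of_set (col_set t c)"
    using dist by (simp add: set[symmetric] sorted_list_of_set_sort_remdups distinct_remdups_id)
  \<comment> \<open>\<open>rho\<close> vanishes in column 0 by definition, so the entry set there
    must be empty too.\<close>
  have empty: "col_set t c = {}" if "c = 0"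
    using sub that set ce by (auto simp: xs_def)
  show ?thesis
    unfolding rho_def Let_def case_prod_conv L desc_def using empty by (cases "c = 0") auto
qed

lemma leq_c_singleton: "1 \<le> i \<Longrightarrow> leq_c [1] [i]"
proof (induction i rule: dec_induct)
  case (step n)
  have "cover_c [n] [Suc n]" unfolding cover_c_def by auto
  then show ?case using step unfolding leq_c_def by (auto intro: rtranclp.rtrancl_into_rtrancl)
qed (simp add: leq_c_def)

text \<open>The rows are built from bottom to top: prepend a part 1, then enlarge it. The cover
  condition is vacuous for the first part.\<close>

lemma leq_c_append:
  assumes "leq_c be al" "is_composition ga"
  shows "leq_c be (ga @ al)"
  using assms(2)
proof (induction ga)
  case (Cons a ga)
  have "1 \<le> a" using Cons.prems by (simp add: is_composition_def Suc_le_eq)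
  then have "leq_c be (a # ga @ al)"
  proof (induction a rule: dec_induct)
    case base
    have "cover_c (ga @ al) (1 # ga @ al)" unfolding cover_c_def by simp
    then show ?case using Cons unfolding leq_c_def is_composition_def
      by (auto intro: rtranclp.rtrancl_into_rtrancl)
  next
    case (step n)
    have "cover_c (n # ga @ al) (Suc n # ga @ al)"
      unfolding cover_c_def by (intro disjI2 exI[of _ 0]) simp
    then show ?case using step unfolding leq_c_def by (auto intro: rtranclp.rtrancl_into_rtrancl)
  qed
  then show ?case by simp
qed (use assms(1) in simp)

text \<open>The only new triples have the appended row as their lower row, and \<open>rows\<close>
  is their condition. The first box of that row is the inner box, so the condition on column 1
  concerns old rows only.\<close>

lemma SSRCT_append_row:
  assumes "comp_tableau ga t" "is_composition ga" "1 \<le> i"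
    and pos: "\<And>c. 2 \<le> c \<Longrightarrow> c \<le> i \<Longrightarrow> 1 \<le> e c"
    and mono: "\<And>c. 2 \<le> c \<Longrightarrow> c < i \<Longrightarrow> e (Suc c) \<le> e c"
    and rows: "\<And>c s. 2 \<le> c \<Longrightarrow> c \<le> i \<Longrightarrow> e c \<le> t (s, c - 1) \<Longrightarrow> e c < t (s, c)"
  defines "u \<equiv> \<lambda>(r, c). if 1 \<le> r \<and> r \<le> length ga then t (r, c)
    else if r = Suc (length ga) \<and> 2 \<le> c \<and> c \<le> i then e c else 0"
  shows "SSRCT (ga @ [i]) [1] u"
    and "col_set u c = (if 2 \<le> c \<and> c \<le> i then insert (e c) (col_set t c) else col_set t c)"
proof -
  let ?n = "length ga"
  have box: "t (r, c) \<noteq> 0 \<longleftrightarrow> (r, c) \<in> cboxes ga" for r c by (rule comp_tableauD(1)[OF assms(1)])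
  have t0: "t (r, c) = 0" if "\<not> (1 \<le> r \<and> r \<le> ?n)" for r c
    using box[of r c] that by (auto simp: cboxes_def)
  have inner: "inner_boxes (ga @ [i]) [1] = {(Suc ?n, 1)}"
    by (auto simp: inner_boxes_def)
  have skew: "skew_boxes (ga @ [i]) [1] = cboxes ga \<union> {(Suc ?n, c) |c. 2 \<le> c \<and> c \<le> i}"
    unfolding skew_boxes_def inner
    by (auto simp: cboxes_def nth_append le_Suc_eq split: if_splits)
  note skew = skew skew[unfolded One_nat_def] and inner = inner inner[unfolded One_nat_def]
  have u_old: "u (r, c) = t (r, c)" if "r \<noteq> Suc ?n" for r c
    using that t0[of r c] by (auto simp: u_def)
  have u_new: "u (Suc ?n, c) = (if 2 \<le> c \<and> c \<le> i then e c else 0)" for c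
    by (simp add: u_def)
  have old: "r \<noteq> Suc ?n" "1 \<le> r" "r \<le> ?n" if "(r, c) \<in> cboxes ga" for r c
    using that by (auto simp: cboxes_def)
  have u_box: "u (r, c) \<noteq> 0 \<longleftrightarrow> (r, c) \<in> skew_boxes (ga @ [i]) [1]" for r c
  proof (cases "r = Suc ?n")
    case True
    then show ?thesis using pos[of c] old(1)[of r c] by (auto simp: skew u_new)
  next
    case False
    then show ?thesis using u_old box by (simp add: skew)
  qed
  show "SSRCT (ga @ [i]) [1] u"
    unfolding SSRCT_def
  proof (intro conjI allI impI ballI)
    show "is_composition (ga @ [i])" using assms(2,3) by (simp add: is_composition_def)
    show "is_composition [1]" by (simp add: is_composition_def)
    show "leq_c [1] (ga @ [i])"
      using leq_c_append[OF leq_c_singleton[OF assms(3)] assms(2)] .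
    show "u x = 0" if "x \<notin> skew_boxes (ga @ [i]) [1]" for x
      using u_box that by (cases x) blast
    show "0 < u x" if "x \<in> skew_boxes (ga @ [i]) [1]" for x
      using u_box that by (cases x) blast
    show "u (r, Suc c) \<le> u (r, c)"
      if b: "(r, c) \<in> skew_boxes (ga @ [i]) [1] \<and> (r, Suc c) \<in> skew_boxes (ga @ [i]) [1]" for r c
    proof (cases "r = Suc ?n")
      case True
      then have "2 \<le> c" "c < i" using b old(1)[of r] by (auto simp: skew)
      then show ?thesis using True mono u_new by simp
    next
      case False
      then have "1 \<le> c" using b by (auto simp: skew cboxes_def)
      then show ?thesis using u_old[OF False] comp_tableauD(2)[OF assms(1)] by simp
    qed
    show "u (r, 1) < u (s, 1)"
      if "r < s \<and> (r, 1) \<in> skew_boxes (ga @ [i]) [1] \<and> (s, 1) \<in> skew_boxes (ga @ [i]) [1]" for r s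
    proof -
      have "(r, 1) \<in> cboxes ga" "(s, 1) \<in> cboxes ga" using that by (auto simp: skew)
      then show ?thesis
        using that comp_tableauD(3)[OF assms(1), of r s] box u_old[OF old(1)] by metis
    qed
    show "(r, Suc c) \<in> inner_boxes (ga @ [i]) [1] \<or>
        (r, Suc c) \<in> skew_boxes (ga @ [i]) [1] \<and> u (s, Suc c) < u (r, Suc c)"
      if a: "r < s \<and> 1 \<le> c \<and> (s, Suc c) \<in> skew_boxes (ga @ [i]) [1] \<and>
        ((r, c) \<in> inner_boxes (ga @ [i]) [1] \<or> u (s, Suc c) \<le> u (r, c))" for r s c
    proof -
      \<comment> \<open>The upper row of a triple is thus an old one, so it cannot contain the inner
        box.\<close>
      have "s \<le> Suc ?n" using a old(3)[of s] by (force simp: skew)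
      then have r: "r \<noteq> Suc ?n" using a by simp
      then have le: "u (s, Suc c) \<le> t (r, c)" using a u_old by (simp add: inner)
      have "u (s, Suc c) < t (r, Suc c)"
      proof (cases "s = Suc ?n")
        case True
        then have "2 \<le> Suc c \<and> Suc c \<le> i" using a old(1)[of s] by (auto simp: skew)
        then show ?thesis using rows[of "Suc c" r] le True u_new by simp
      next
        case False
        then have "t (s, Suc c) \<noteq> 0" using a box by (auto simp: skew)
        then show ?thesis using comp_tableauD(4)[OF assms(1), of r s c] a le u_old[OF False] by simp
      qed
      then show ?thesis using u_old[OF r] u_box[of r "Suc c"] by simp
    qed
  qed
  show "col_set u c = (if 2 \<le> c \<and> c \<le> i then insert (e c) (col_set t c) else col_set t c)"
  proof (intro set_eqI)
    fix y
    have "(\<exists>r. u (r, c) = y) \<longleftrightarrow> (\<exists>r. t (r, c) = y) \<or> u (Suc ?n, c) = y" if "y \<noteq> 0"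
      using u_old[of _ c] t0[of "Suc ?n" c] that by (metis Suc_n_not_le_n)
    then show "y \<in> col_set u c \<longleftrightarrow>
      y \<in> (if 2 \<le> c \<and> c \<le> i then insert (e c) (col_set t c) else col_set t c)"
      using pos[of c] by (auto simp: col_set_iff u_new)
  qed
qed

section \<open>Column heights and the comparison of both sides\<close>

lemma card_col_set:
  assumes "comp_tableau al t"
  shows "card (col_set t c) = card {r. t (r, c) \<noteq> 0}"
  unfolding col_set_eq
proof (intro card_image inj_onI)
  show "r = s" if "r \<in> {r. t (r, c) \<noteq> 0}" "t (r, c) = t (s, c)" for r s
    using comp_tableau_inj[OF assms _ that(2)] that(1) by blast
qed

lemma card_pboxes_column:
  "1 \<le> c \<Longrightarrow> card {r. (r, c) \<in> pboxes lam} = length (filter (\<lambda>x. c \<le> x) lam)"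
proof -
  assume c: "1 \<le> c"
  have "{r. (r, c) \<in> pboxes lam} = Suc ` {j. j < length lam \<and> c \<le> lam ! j}"
  proof (intro set_eqI)
    fix r
    show "r \<in> {r. (r, c) \<in> pboxes lam} \<longleftrightarrow> r \<in> Suc ` {j. j < length lam \<and> c \<le> lam ! j}"
      using c by (cases r) (auto simp: pboxes_def)
  qed
  then show ?thesis by (simp add: card_image length_filter_conv_card)
qed

text \<open>The preimage of \<open>T\<close> under rho is given as an SSRCT \<open>t\<close> mapped
  to \<open>T\<close>. The claimed equality is stated after applying rho for the inner shape (1) to
  both sides, which is equivalent by the bijectivity of that map.\<close>

theorem theorem5p3:
  fixes i :: nat and lam :: "nat list" and T :: filling
    and al :: "nat list" and t :: filling
  assumes "1 \<le> i"
    and "is_partition lam"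
    and "SSRT lam [] T"
    and "\<exists>r. addable_node lam (r, i)"
    and "SSRCT al [] t"
    and "rho [] al t = T"
  shows "\<exists>ga s. mu i (al, t) = Some (ga, s) \<and> SSRCT ga [1] s \<and> rho [1] ga s = jdt lam i T"
proof -
  have ct: "comp_tableau al t" by (rule SSRCT_Nil_comp_tableau[OF assms(5)])
  have comp: "is_composition al" using assms(5) by (simp add: SSRCT_def)
  let ?A = "col_set t"
  have fin: "finite (?A c)" for c by (rule finite_col_set[OF ct])
  have T: "T (r, c) = desc (?A c) r" for r c
    using rho_desc[OF assms(5)] assms(6) by auto
  have box: "pboxes lam - pboxes [] = pboxes lam" by (auto simp: pboxes_def)
  note T' = assms(3)[unfolded SSRT_def box]
  have "\<forall>x. x \<notin> pboxes lam \<longrightarrow> T x = 0" "\<forall>x \<in> pboxes lam. 0 < T x"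
    by (rule T'[THEN conjunct1], rule T'[THEN conjunct2, THEN conjunct1])
  then have T_box: "T x \<noteq> 0 \<longleftrightarrow> x \<in> pboxes lam" for x
    by (metis less_irrefl)
  have column: "{r. (r, c) \<in> pboxes lam} = {1..card (?A c)}" for c
  proof (intro set_eqI)
    fix r
    show "r \<in> {r. (r, c) \<in> pboxes lam} \<longleftrightarrow> r \<in> {1..card (?A c)}"
      using desc_eq_0_iff[OF fin zero_notin_col_set, of r c] T_box[of "(r, c)"] T[of r c]
      by (cases "r = 0") auto
  qed
  have height: "length (filter (\<lambda>x. i \<le> x) lam) = card (?A i)"
    using card_pboxes_column[OF assms(1), of lam] column[of i] by simp
  have "i = 1 \<or> i - 1 \<in> set al"
  proof (cases "i = 1")
    case i: False
    \<comment> \<open>The box left of the addable node lies in \<open>lam\<close>, so column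
      \<open>i\<close> is shorter than column \<open>i - 1\<close>. Hence some row of
      \<open>al\<close> ends exactly in column \<open>i - 1\<close>.\<close>
    obtain r nu where nu: "(r, i) \<notin> pboxes lam" "pboxes nu = insert (r, i) (pboxes lam)"
      using assms(4) unfolding addable_node_def by blast
    have "(r, i) \<in> pboxes nu" using nu by simp
    then have "(r, i - 1) \<in> pboxes nu" using i assms(1) by (auto simp: pboxes_def)
    then have "(r, i - 1) \<in> pboxes lam" using nu i assms(1) by auto
    then have "r \<in> {1..card (?A (i - 1))}" "r \<notin> {1..card (?A i)}"
      using nu(1) column[of i] column[of "i - 1"] by blast+
    then have "card (?A i) < card (?A (i - 1))" by auto
    then have "\<not> {r. t (r, i - 1) \<noteq> 0} \<subseteq> {r. t (r, i) \<noteq> 0}"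
      using card_mono[OF comp_tableau_finite_rows[OF ct]] unfolding card_col_set[OF ct] by (metis leD)
    then obtain q where "t (q, i - 1) \<noteq> 0" "t (q, i) = 0" by auto
    then have "(q, i - 1) \<in> cboxes al" "(q, i) \<notin> cboxes al"
      using comp_tableauD(1)[OF ct] by blast+
    then have "q - 1 < length al" "al ! (q - 1) = i - 1" by (auto simp: cboxes_def)
    then have "i - 1 \<in> set al" by (metis nth_mem)
    then show ?thesis ..
  qed simp
  from phis_spec[OF ct comp assms(1) this] obtain ga t' e f where
    phis: "phis i (al, t) = Some ((ga, t'), map e (rev [2..<Suc i]))"
    "is_composition ga" "comp_tableau ga t'" and
    cols: "\<forall>c. col_set t' c = (if 1 \<le> c \<and> c < i then ?A c - {e (Suc c)} else ?A c)" and
    exits: "\<forall>q. 2 \<le> q \<and> q \<le> i \<longrightarrow>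
      exits (?A (q - 1)) (if q = i then ?A i else ?A q - {e (Suc q)}) (e q) \<and>
      (\<forall>s. e q \<le> t' (s, q - 1) \<longrightarrow> e q < t' (s, q))" and
    "\<forall>s c. i \<le> c \<longrightarrow> t' (s, c) = t (f s, c)"
    by (elim exE conjE) (rule that; assumption)
  have ex: "exits (?A (q - 1)) (if q = i then ?A i else ?A q - {e (Suc q)}) (e q)"
    and rows: "e q \<le> t' (s, q - 1) \<Longrightarrow> e q < t' (s, q)"
    if "2 \<le> q" "q \<le> i" for q s
    using exits that by blast+
  have pos: "1 \<le> e c" if "2 \<le> c" "c \<le> i" for c
    using ex[OF that] by (cases "e c") (auto simp: exits_def)
  \<comment> \<open>Rows of \<open>t\<close> decrease weakly, so column \<open>q - 1\<close>
    dominates column \<open>q\<close> in every count, as \<open>exits_mono\<close> requires.\<close>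
  have mono: "e (Suc q) \<le> e q" if q: "2 \<le> q" "q < i" for q
  proof (rule exits_mono)
    show "exits (?A (q - 1)) (?A q - {e (Suc q)}) (e q)" using ex[of q] q by simp
    show "e (Suc q) \<in> ?A q" using ex[of "Suc q"] q by (simp add: exits_def)
    show "cnt (?A q) y \<le> cnt (?A (q - 1)) y" if "1 \<le> y" for y
      using cnt_col_set_Suc_le[OF ct, of "q - 1" y] q that by simp
  qed (rule fin)+
  have sorted: "sorted (map e (rev [2..<Suc i]))"
  proof -
    have "e b \<le> e a" if "2 \<le> a" "a \<le> b" "b \<le> i" for a b
      using that(2,3)
    proof (induction b rule: dec_induct)
      case (step n)
      then show ?case using mono[of n] that(1) by simp
    qed simp
    then show ?thesis
      unfolding sorted_map sorted_wrt_rev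
      unfolding sorted_wrt_iff_nth_less by (simp del: upt_Suc)
  qed
  define u where "u = (\<lambda>(r, c). if 1 \<le> r \<and> r \<le> length ga then t' (r, c)
    else if r = Suc (length ga) \<and> 2 \<le> c \<and> c \<le> i then e c else 0)"
  \<comment> \<open>The exits arrive as \<open>e i\<close>, ..., \<open>e 2\<close>, which is
    already increasing. Reversal puts \<open>e 2\<close> first, and \<open>e 2\<close> belongs in
    column 2, whence the offset.\<close>
  have H: "rev (sort (map e (rev [2..<Suc i]))) ! (c - 2) = e c" if "2 \<le> c" "c \<le> i" for c
    using that le_add_diff_inverse[OF that(1)] by (simp add: sorted_sort_id[OF sorted] rev_map del: upt_Suc)
  have mu: "mu i (al, t) = Some (ga @ [i], u)"
    using assms(1) H phis(1) by (auto simp: mu_def u_def fun_eq_iff simp del: upt_Suc phis.simps)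
  have u: "SSRCT (ga @ [i]) [1] u"
    "col_set u c = (if 2 \<le> c \<and> c \<le> i then insert (e c) (col_set t' c) else col_set t' c)" for c
    unfolding u_def
    by (rule SSRCT_append_row[OF phis(3,2) assms(1)]; use pos mono rows in blast)+
  have "rho [1] (ga @ [i]) u (r, c) = jdt lam i T (r, c)" for r c
  proof -
    let ?p = "Suc (card (?A i))"
    \<comment> \<open>The addable node sits directly above column \<open>i\<close>, so the untouched
      tableau already has the form of a column with a hole.\<close>
    have hole: "T (r, i) = hole_col (?A i) ?p r" for r
      using T[of r i] by (auto simp: hole_col_def desc_def)
    have "jdt lam i T = jdt_aux T ?p i" by (simp add: jdt_def height)
    also have "\<dots> = (\<lambda>(r, c). if c = 0 \<or> i < c then T (r, c)
      else let D = (if c = i then ?A i else ?A c - {e (Suc c)})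
        in if c = 1 then desc D (r - 1) else desc (insert (e c) D) r)"
      \<comment> \<open>Column \<open>i\<close> has lost nothing at the start, so its current set is
        the original one.\<close>
      by (rule jdt_columns[of ?A i "?A i" e])
        (use fin ex mono assms(1) hole T cnt_le_card in auto)
    finally have J: "jdt lam i T (r, c) = (if c = 0 \<or> i < c then T (r, c)
      else let D = (if c = i then ?A i else ?A c - {e (Suc c)})
        in if c = 1 then desc D (r - 1) else desc (insert (e c) D) r)"
      by simp
    have "?A 0 = {}" using comp_tableauD(1)[OF ct] by (auto simp: col_set_iff cboxes_def)
    then have zero: "desc (?A 0) k = 0" for k by (simp add: desc_def)
    show ?thesis
      \<comment> \<open>The inner box lifts column 1 by one row in \<open>rho\<close>, matching the
        shift that the hole leaves in column 1 under \<open>jdt\<close>; other positive columns are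
        not lifted, and column 0 is empty on both sides.\<close>
      unfolding J rho_desc[OF u(1)] u(2) cols[rule_format] T
      using assms(1) by (auto simp: Let_def zero)
  qed
  then have "rho [1] (ga @ [i]) u = jdt lam i T" by auto
  with mu u(1) show ?thesis by blast
qed

end
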